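(* For every $m\ge 3$, the cycle graph $C_m$ on $m$ vertices satisfies $\beta(C_m)=\alpha(C_m)$, and consequently $\overline{\mathcal{Q}}(\mathcal{S}_{ac}(C_m))=\operatorname{STAB}(C_m)$.
   Context: $\alpha(G)$ is the independence number of a finite simple graph $G$ with vertex set $\{1,\dots,n\}$. $\mathcal{S}_{ac}(G)$ is the class of all self-adjoint unitary representations (SAURs) of $G$: families $\{S_i\}_{i=1}^n$ of self-adjoint operators on some Hilbert space with $S_i^2=\mathbb{I}$, $S_iS_j=-S_jS_i$ for adjacent $i,j$, and $S_iS_j=S_jS_i$ for non-adjacent $i,j$. $\overline{\mathcal{Q}}(\mathcal{S}_{ac}(G))\subset\mathbb{R}^n$ is the convex hull of the set of all vectors $((\operatorname{Tr}\rho S_1)^2,\dots,(\operatorname{Tr}\rho S_n)^2)$ with $\{S_i\}\in\mathcal{S}_{ac}(G)$ and $\rho$ a density operator on the corresponding Hilbert space. $\beta(G)$ is the supremum of $\sum_i(\operatorname{Tr}\rho S_i)^2$ over all such $\{S_i\}$ and $\rho$. $\operatorname{STAB}(G)$ is the convex hull of $\{v\in\{0,1\}^n: v_iv_j=0\text{ if } i,j\text{ adjacent}\}$. *)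

theory Defs
  imports "HOL-Analysis.Analysis"
begin

(* Hilbert spaces are given by carrier sets rather than by a type class, because the sets and
   suprema below range over all Hilbert spaces at once.  The inner product is conjugate-linear
   in its first argument. *)

record 'v hspace =
  hcarrier :: "'v set"
  hzero :: 'v
  hadd :: "'v \<Rightarrow> 'v \<Rightarrow> 'v"
  hscale :: "complex \<Rightarrow> 'v \<Rightarrow> 'v"
  hinner :: "'v \<Rightarrow> 'v \<Rightarrow> complex"

definition hnorm :: "'v hspace \<Rightarrow> 'v \<Rightarrow> real" where
  "hnorm H x = sqrt (Re (hinner H x x))"

definition hdist :: "'v hspace \<Rightarrow> 'v \<Rightarrow> 'v \<Rightarrow> real" where
  "hdist H x y = hnorm H (hadd H x (hscale H (- 1) y))"

locale complex_hilbert_space =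
  fixes H :: "'v hspace"
  assumes zero_closed: "hzero H \<in> hcarrier H"
    and add_closed: "\<lbrakk>x \<in> hcarrier H; y \<in> hcarrier H\<rbrakk> \<Longrightarrow> hadd H x y \<in> hcarrier H"
    and scale_closed: "x \<in> hcarrier H \<Longrightarrow> hscale H c x \<in> hcarrier H"
    and add_assoc: "\<lbrakk>x \<in> hcarrier H; y \<in> hcarrier H; z \<in> hcarrier H\<rbrakk>
          \<Longrightarrow> hadd H (hadd H x y) z = hadd H x (hadd H y z)"
    and add_commute: "\<lbrakk>x \<in> hcarrier H; y \<in> hcarrier H\<rbrakk> \<Longrightarrow> hadd H x y = hadd H y x"
    and add_zero: "x \<in> hcarrier H \<Longrightarrow> hadd H x (hzero H) = x"
    and add_neg: "x \<in> hcarrier H \<Longrightarrow> hadd H x (hscale H (- 1) x) = hzero H"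
    and scale_one: "x \<in> hcarrier H \<Longrightarrow> hscale H 1 x = x"
    and scale_scale: "x \<in> hcarrier H \<Longrightarrow> hscale H a (hscale H b x) = hscale H (a * b) x"
    and scale_add_left: "x \<in> hcarrier H
          \<Longrightarrow> hscale H (a + b) x = hadd H (hscale H a x) (hscale H b x)"
    and scale_add_right: "\<lbrakk>x \<in> hcarrier H; y \<in> hcarrier H\<rbrakk>
          \<Longrightarrow> hscale H a (hadd H x y) = hadd H (hscale H a x) (hscale H a y)"
    and inner_commute: "\<lbrakk>x \<in> hcarrier H; y \<in> hcarrier H\<rbrakk> \<Longrightarrow> hinner H y x = cnj (hinner H x y)"
    and inner_add_right: "\<lbrakk>x \<in> hcarrier H; y \<in> hcarrier H; z \<in> hcarrier H\<rbrakk>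
          \<Longrightarrow> hinner H x (hadd H y z) = hinner H x y + hinner H x z"
    and inner_scale_right: "\<lbrakk>x \<in> hcarrier H; y \<in> hcarrier H\<rbrakk>
          \<Longrightarrow> hinner H x (hscale H a y) = a * hinner H x y"
    and inner_nonneg: "x \<in> hcarrier H \<Longrightarrow> 0 \<le> Re (hinner H x x)"
    and inner_definite: "\<lbrakk>x \<in> hcarrier H; hinner H x x = 0\<rbrakk> \<Longrightarrow> x = hzero H"
    and complete: "\<lbrakk>\<And>n::nat. X n \<in> hcarrier H;
            \<forall>e>0. \<exists>N. \<forall>m\<ge>N. \<forall>n\<ge>N. hdist H (X m) (X n) < e\<rbrakk>
          \<Longrightarrow> \<exists>x\<in>hcarrier H. (\<lambda>n. hdist H (X n) x) \<longlonglongrightarrow> 0"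

(* Operators are functions on the underlying type; only their values on the carrier matter. *)

definition bounded_operator :: "'v hspace \<Rightarrow> ('v \<Rightarrow> 'v) \<Rightarrow> bool" where
  "bounded_operator H A \<longleftrightarrow>
     (\<forall>x\<in>hcarrier H. A x \<in> hcarrier H) \<and>
     (\<forall>x\<in>hcarrier H. \<forall>y\<in>hcarrier H. A (hadd H x y) = hadd H (A x) (A y)) \<and>
     (\<forall>c. \<forall>x\<in>hcarrier H. A (hscale H c x) = hscale H c (A x)) \<and>
     (\<exists>K. \<forall>x\<in>hcarrier H. hnorm H (A x) \<le> K * hnorm H x)"

definition self_adjoint_operator :: "'v hspace \<Rightarrow> ('v \<Rightarrow> 'v) \<Rightarrow> bool" where
  "self_adjoint_operator H A \<longleftrightarrow>
     bounded_operator H A \<and>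
     (\<forall>x\<in>hcarrier H. \<forall>y\<in>hcarrier H. hinner H (A x) y = hinner H x (A y))"

definition positive_operator :: "'v hspace \<Rightarrow> ('v \<Rightarrow> 'v) \<Rightarrow> bool" where
  "positive_operator H A \<longleftrightarrow>
     self_adjoint_operator H A \<and> (\<forall>x\<in>hcarrier H. 0 \<le> Re (hinner H x (A x)))"

(* An orthonormal basis in the Hilbert space sense: a complete orthonormal system. *)

definition orthonormal_basis :: "'v hspace \<Rightarrow> 'v set \<Rightarrow> bool" where
  "orthonormal_basis H B \<longleftrightarrow>
     B \<subseteq> hcarrier H \<and>
     (\<forall>e\<in>B. \<forall>f\<in>B. hinner H e f = (if e = f then 1 else 0)) \<and>
     (\<forall>x\<in>hcarrier H. (\<forall>e\<in>B. hinner H e x = 0) \<longrightarrow> x = hzero H)"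

(* The trace as a relation, in the style of has_sum and has_integral: A has trace t if the sum of
   its diagonal entries converges unconditionally to t in every orthonormal basis.  For bounded
   A this holds for some t exactly when A is trace class. *)

definition has_trace :: "'v hspace \<Rightarrow> ('v \<Rightarrow> 'v) \<Rightarrow> complex \<Rightarrow> bool" where
  "has_trace H A t \<longleftrightarrow>
     (\<forall>B. orthonormal_basis H B \<longrightarrow> ((\<lambda>e. hinner H e (A e)) has_sum t) B)"

definition density_operator :: "'v hspace \<Rightarrow> ('v \<Rightarrow> 'v) \<Rightarrow> bool" where
  "density_operator H \<rho> \<longleftrightarrow> positive_operator H \<rho> \<and> has_trace H \<rho> 1"

(* A finite simple graph is given by its adjacency relation E on a finite vertex type. *)

definition SAUR :: "'v hspace \<Rightarrow> ('n \<Rightarrow> 'n \<Rightarrow> bool) \<Rightarrow> ('n \<Rightarrow> 'v \<Rightarrow> 'v) \<Rightarrow> bool" where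
  "SAUR H E S \<longleftrightarrow>
     (\<forall>i. self_adjoint_operator H (S i)) \<and>
     (\<forall>i. \<forall>x\<in>hcarrier H. S i (S i x) = x) \<and>
     (\<forall>i j. E i j \<longrightarrow> (\<forall>x\<in>hcarrier H. S i (S j x) = hscale H (- 1) (S j (S i x)))) \<and>
     (\<forall>i j. \<not> E i j \<longrightarrow> (\<forall>x\<in>hcarrier H. S i (S j x) = S j (S i x)))"

(* The Hilbert spaces range over all those whose vectors are elements of the type 'v.  An
   injection from complex into 'v makes this universe contain an isomorphic copy of every
   separable Hilbert space; a finite 'v would leave only the zero space.
   If rho is a density operator and S i is self-adjoint, then rho S i is trace class with real
   trace, so the has_trace condition only names that trace and never excludes a pair (S, rho). *)

definition squared_expectations ::
    "'v itself \<Rightarrow> ('n::finite \<Rightarrow> 'n \<Rightarrow> bool) \<Rightarrow> (real ^ 'n) set" where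
  "squared_expectations _ E =
     {(\<chi> i. (t i)\<^sup>2) | t. \<exists>(H :: 'v hspace) S \<rho>.
        complex_hilbert_space H \<and> SAUR H E S \<and> density_operator H \<rho> \<and>
        (\<forall>i. has_trace H (\<rho> \<circ> S i) (complex_of_real (t i)))}"

definition Qbar :: "'v itself \<Rightarrow> ('n::finite \<Rightarrow> 'n \<Rightarrow> bool) \<Rightarrow> (real ^ 'n) set" where
  "Qbar U E = convex hull (squared_expectations U E)"

definition beta :: "'v itself \<Rightarrow> ('n::finite \<Rightarrow> 'n \<Rightarrow> bool) \<Rightarrow> real" where
  "beta U E = (SUP q\<in>squared_expectations U E. \<Sum>i\<in>UNIV. q $ i)"

definition independent_set :: "('n \<Rightarrow> 'n \<Rightarrow> bool) \<Rightarrow> 'n set \<Rightarrow> bool" where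
  "independent_set E A \<longleftrightarrow> (\<forall>i\<in>A. \<forall>j\<in>A. \<not> E i j)"

definition independence_number :: "('n::finite \<Rightarrow> 'n \<Rightarrow> bool) \<Rightarrow> nat" where
  "independence_number E = Max (card ` {A. independent_set E A})"

definition STAB :: "('n::finite \<Rightarrow> 'n \<Rightarrow> bool) \<Rightarrow> (real ^ 'n) set" where
  "STAB E = convex hull
     {v. (\<forall>i. v $ i \<in> {0, 1}) \<and> (\<forall>i j. E i j \<longrightarrow> v $ i * v $ j = 0)}"

(* The bijection forces the vertex type to have exactly m elements. *)

definition is_cycle_graph :: "nat \<Rightarrow> ('n::finite \<Rightarrow> 'n \<Rightarrow> bool) \<Rightarrow> bool" where
  "is_cycle_graph m E \<longleftrightarrow>
     (\<exists>v :: nat \<Rightarrow> 'n. bij_betw v {..<m} UNIV \<and>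
        (\<forall>i<m. \<forall>j<m. E (v i) (v j) \<longleftrightarrow> j = (i + 1) mod m \<or> i = (j + 1) mod m))"

end

theory Submission
  imports Defs
begin

text \<open>Upper bound.  Adjacent vertices satisfy \<open>t\<^sub>i\<^sup>2 + t\<^sub>j\<^sup>2 \<le> 1\<close> because their observables anticommute.  For odd
  \<open>m\<close> the generators behave like products \<open>\<i> \<gamma>\<^sub>j \<gamma>\<^sub>j\<^sub>+\<^sub>1\<close> of Majorana operators, up to a central
  involution that is diagonalised by splitting the state into two parts.  Each part has a covariance
  matrix that is real antisymmetric of odd order \<open>m\<close>, hence singular, and so its Frobenius norm,
  which dominates the expectations \<open>t\<^sub>j\<close>, is that of a contraction of rank at most \<open>m - 1\<close>.
  This gives \<open>\<Sum>t\<^sub>j\<^sup>2 \<le> (m - 1) / 2\<close>.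

  Conversely the edge inequalities together with \<open>\<Sum>x\<^sub>j \<le> \<lfloor>m / 2\<rfloor>\<close> describe \<open>STAB\<close>, and indicators of
  independent sets are attained by explicit signed bit-flip operators.\<close>

section \<open>The stable set polytope of a cycle\<close>

text \<open>For even \<open>m\<close> the edge inequalities already add up to the bound; for odd
  \<open>m\<close> they miss it by 1/2, and the Majorana picture closes this gap. It is available
  because a cycle is its own line graph: gamma_j gamma_{j+1} and gamma_k gamma_{k+1} anticommute
  exactly when the two index pairs share one element. Genuine Majorana operators would force the
  ordered product of all generators to be a scalar; in an arbitrary representation it is only
  central, whence the involution. If c denotes its expectation, the two parts carry the weights 1 +
  c and 1 - c up to a common factor, so that c drops out of the total. Each expectation fills two
  entries of an antisymmetric matrix, which turns m - 1 into (m - 1) / 2. No Majorana operators are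
  constructed. Only the traces of rho and of rho times one generator are given, so all computations
  take place in a positive functional \<open>F u w\<close> on pairs of words in the generators, and
  a pair gamma_j, gamma_k is represented by the word of the generators between them.\<close>

lemma measure_frac_less:
  fixes p x :: real
  assumes "0 \<le> x" "x \<le> 1"
  shows "measure lborel {\<theta>\<in>{0..<1}. frac (\<theta> - p) < x} = x"
proof -
  define q where "q = frac p"
  have q: "0 \<le> q" "q < 1" by (auto simp: q_def frac_lt_1)
  have fr: "frac (\<theta> - p) = (if q \<le> \<theta> then \<theta> - q else \<theta> - q + 1)" if "\<theta> \<in> {0..<1}" for \<theta>
  proof -
    have e: "\<theta> - p = (if q \<le> \<theta> then \<theta> - q else \<theta> - q + 1) + of_int (if q \<le> \<theta> then - \<lfloor>p\<rfloor> else - \<lfloor>p\<rfloor> - 1)"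
      by (auto simp: q_def frac_def)
    show ?thesis
      using that q unfolding frac_unique_iff by (subst (1) e) auto
  qed
  show ?thesis
  proof (cases "q + x \<le> 1")
    case True
    have "{\<theta>\<in>{0..<1}. frac (\<theta> - p) < x} = {q..<q+x}"
      using True q assms by (auto simp: fr split: if_splits)
    then show ?thesis using assms by simp
  next
    case False
    have "{\<theta>\<in>{0..<1}. frac (\<theta> - p) < x} = {q..<1} \<union> {0..<q+x-1}"
      using False q assms by (auto simp: fr split: if_splits)
    moreover have "measure lborel ({q..<1} \<union> {0..<q+x-1}) = measure lborel {q..<1} + measure lborel {0..<q+x-1}"
      using q assms False by (intro measure_Union) auto
    ultimately show ?thesis using assms q False by simp
  qed
qed

lemma bij_betw_succ_mod: "bij_betw (\<lambda>j. (j+1) mod m) {..<m} {..<m :: nat}"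
proof -
  have "inj_on (\<lambda>j. (j+1) mod m) {..<m}"
  proof (rule inj_onI)
    fix i j assume "i \<in> {..<m}" "j \<in> {..<m}" "(i + 1) mod m = (j + 1) mod m"
    then show "i = j" by (auto simp: mod_Suc split: if_splits)
  qed
  then show ?thesis
    by (simp add: bij_betw_def endo_inj_surj image_subset_iff)
qed

lemma cycle_adj_succ:
  assumes "bij_betw v {..<m} UNIV"
    and "\<forall>i<m. \<forall>j<m. E (v i) (v j) \<longleftrightarrow> j = (i + 1) mod m \<or> i = (j + 1) mod m"
    and "E a b"
  obtains i where "i < m" "a = v i \<and> b = v ((i+1) mod m) \<or> b = v i \<and> a = v ((i+1) mod m)"
proof -
  obtain i j where "i < m" "j < m" "a = v i" "b = v j"
    using assms(1) by (metis UNIV_I bij_betw_imp_surj_on imageE lessThan_iff)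
  with assms that show ?thesis by metis
qed

text \<open>Put arcs of length \<open>x (v j)\<close> on the circle of circumference 1, each one starting at or after the
  end of its predecessor, with gaps chosen such that the last arc is followed by the first.  The
  vertices whose arcs contain a random point form an independent set, which contains \<open>v j\<close> with
  probability \<open>x (v j)\<close>.\<close>

lemma cycle_polytope_subset_STAB:
  fixes E :: "'n::finite \<Rightarrow> 'n \<Rightarrow> bool" and x :: "real ^ 'n"
  assumes m: "2 \<le> m" and v: "bij_betw v {..<m} UNIV"
    and E: "\<forall>i<m. \<forall>j<m. E (v i) (v j) \<longleftrightarrow> j = (i + 1) mod m \<or> i = (j + 1) mod m"
    and nonneg: "\<And>i. 0 \<le> x $ i"
    and edge: "\<And>i j. E i j \<Longrightarrow> x $ i + x $ j \<le> 1"
    and total: "(\<Sum>i\<in>UNIV. x $ i) \<le> real (m div 2)"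
  shows "x \<in> STAB E"
proof -
  define X where "X = (\<Sum>i\<in>UNIV. x $ i)"
  \<comment> \<open>\<open>s j\<close> is the slack of an edge inequality, hence the longest gap
    that fits on the circle together with both arcs. Every gap uses the same fraction
    \<open>l\<close> of its slack. It solves X + l (m - 2 X) = m div 2, so that the arcs wind around
    an integral number of times. If m = 2 X, division by zero gives \<open>l = 0\<close>, which is
    harmless as all slacks add up to 0.\<close>
  define s where "s j = 1 - x $ v j - x $ v ((j+1) mod m)" for j
  define l where "l = (real (m div 2) - X) / (m - 2 * X)"
  define p where "p j = (\<Sum>i<j. x $ v i + l * s i)" for j
  define r where "r = the_inv_into {..<m} v"
  have r: "r (v j) = j" if "j < m" for j
    using v that unfolding r_def bij_betw_def by (intro the_inv_into_f_f) auto
  have vr: "v (r i) = i" "r i < m" for i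
    using v unfolding r_def bij_betw_def
    by (auto intro!: f_the_inv_into_f simp: the_inv_into_into[of _ _ _ "{..<m}", simplified])
  have XS: "(\<Sum>j<m. x $ v j) = X"
    unfolding X_def by (rule sum.reindex_bij_betw[OF v])
  have XS': "(\<Sum>j<m. x $ v ((j+1) mod m)) = X"
    using sum.reindex_bij_betw[OF bij_betw_succ_mod, of "\<lambda>j. x $ v j"] XS by simp
  have S: "(\<Sum>j<m. s j) = m - 2 * X"
    unfolding s_def sum_subtractf XS XS' by simp
  have s0: "0 \<le> s j" if "j < m" for j
    using edge[of "v j" "v ((j+1) mod m)"] E that m by (auto simp: s_def)
  have mX: "X \<le> real (m div 2)" "real (m div 2) \<le> m / 2" using total X_def by auto
  have l: "0 \<le> l" "l \<le> 1"
    using mX by (auto simp: l_def divide_le_eq_1)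
  have pm: "p m = real (m div 2)"
  proof -
    have "p m = X + l * (m - 2 * X)"
      unfolding p_def sum.distrib XS by (simp add: sum_distrib_left[symmetric] S)
    moreover have "l * (m - 2 * X) = real (m div 2) - X"
      using mX by (cases "m = 2 * X") (auto simp: l_def)
    ultimately show ?thesis by simp
  qed
  have x1: "x $ i \<le> 1" for i
    using s0[OF vr(2)[of i]] nonneg[of "v ((r i + 1) mod m)"] by (simp add: s_def vr)
  define sel where "sel \<theta> = {i. frac (\<theta> - p (r i)) < x $ i}" for \<theta>
  have step: "\<not> (v j \<in> sel \<theta> \<and> v ((j+1) mod m) \<in> sel \<theta>)" if j: "j < m" for j \<theta>
  proof
    assume a: "v j \<in> sel \<theta> \<and> v ((j+1) mod m) \<in> sel \<theta>"
    have mm: "(j+1) mod m < m" using m by simp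
    define k where "k = frac (\<theta> - p j)"
    have k: "0 \<le> k" "k < x $ v j" using a r[OF j] by (auto simp: sel_def k_def)
    \<comment> \<open>Behind the last arc the starting point is \<open>p m\<close>, an integer,
      which \<open>frac\<close> identifies with \<open>p 0 = 0\<close>.\<close>
    have fp: "frac (\<theta> - p ((j+1) mod m)) = frac (\<theta> - p (Suc j))"
    proof (cases "j + 1 < m")
      case False
      then have "Suc j = m" using j by simp
      moreover have "p 0 = 0" by (simp add: p_def)
      moreover have "\<theta> = (\<theta> - real (m div 2)) + of_int (int (m div 2))" by simp
      ultimately show ?thesis using pm by (metis Suc_eq_plus1 diff_zero frac_add_of_int_right mod_self)
    qed simp
    have "p (Suc j) = p j + x $ v j + l * s j" by (simp add: p_def)
    then have "\<theta> - p (Suc j) = (1 + k - x $ v j - l * s j) + of_int (\<lfloor>\<theta> - p j\<rfloor> - 1)"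
      by (simp add: k_def frac_def)
    then have f: "frac (\<theta> - p (Suc j)) = frac (1 + k - x $ v j - l * s j)"
      by (metis frac_add_of_int_right)
    have ls: "0 \<le> l * s j" "l * s j \<le> s j" using l s0[OF j] by (auto intro: mult_left_le_one_le)
    have "s j + x $ v j \<le> 1" using nonneg by (simp add: s_def)
    then have "frac (1 + k - x $ v j - l * s j) = 1 + k - x $ v j - l * s j"
      using k ls by (intro frac_eq[THEN iffD2]) auto
    moreover have "frac (\<theta> - p ((j+1) mod m)) < x $ v ((j+1) mod m)"
      using a r[OF mm] by (simp add: sel_def)
    \<comment> \<open>Lying in both arcs would mean 1 + k < x_j + l s_j + x_{j+1}, but the
      right-hand side is at most 1.\<close>
    ultimately show False using k ls unfolding fp f s_def by auto
  qed
  have ind: "\<not> E a b" if "a \<in> sel \<theta>" "b \<in> sel \<theta>" for a b \<theta>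
    using that step by (metis cycle_adj_succ[OF v E])
  define w where "w A = measure lborel {\<theta>\<in>{0..<1}. sel \<theta> = A}" for A
  define y :: "'n set \<Rightarrow> real ^ 'n" where "y A = (\<chi> i. if i \<in> A then 1 else 0)" for A
  define Is where "Is = {A. \<forall>i\<in>A. \<forall>j\<in>A. \<not> E i j}"
  have "{\<theta>\<in>{0..<1}. sel \<theta> = A} = {\<theta>\<in>{0..<1}. \<forall>i\<in>UNIV. (i \<in> A) = (i \<in> sel \<theta>)}" for A
    by auto
  moreover have "{\<theta>\<in>{0..<1}. \<forall>i\<in>UNIV. (i \<in> A) = (i \<in> sel \<theta>)} \<in> sets lborel" for A
    unfolding sel_def frac_def by simp measurable
  ultimately have meas: "{\<theta>\<in>{0..<1}. sel \<theta> = A} \<in> sets lborel" for A by simp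
  have "emeasure lborel {\<theta>\<in>{0..<1}. sel \<theta> = A} \<le> emeasure lborel {0..<1::real}" for A
    by (rule emeasure_mono) auto
  then have fm: "emeasure lborel {\<theta>\<in>{0..<1}. sel \<theta> = A} \<noteq> \<infinity>" for A
    by (rule neq_top_trans[rotated, folded infinity_ennreal_def]) simp
  have wsum: "(\<Sum>A\<in>K. w A) = measure lborel {\<theta>\<in>{0..<1}. sel \<theta> \<in> K}" for K
  proof -
    have "measure lborel (\<Union>A\<in>K. {\<theta>\<in>{0..<1}. sel \<theta> = A}) = (\<Sum>A\<in>K. w A)"
      unfolding w_def using fm meas
      by (intro measure_finite_Union) (auto simp: disjoint_family_on_def)
    moreover have "(\<Union>A\<in>K. {\<theta>\<in>{0..<1}. sel \<theta> = A}) = {\<theta>\<in>{0..<1}. sel \<theta> \<in> K}" by auto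
    ultimately show ?thesis by simp
  qed
  have wI: "w A = 0" if "A \<notin> Is" for A
  proof -
    have "{\<theta>\<in>{0..<1}. sel \<theta> = A} = {}" using that ind by (auto simp: Is_def)
    then show ?thesis unfolding w_def by (simp only: measure_empty)
  qed
  have one: "(\<Sum>A\<in>Is. w A) = 1"
  proof -
    have "{\<theta>\<in>{0..<1::real}. sel \<theta> \<in> Is} = {0..<1}" using ind by (auto simp: Is_def)
    then show ?thesis by (simp add: wsum)
  qed
  have "x = (\<Sum>A\<in>Is. w A *\<^sub>R y A)"
  proof (rule vec_eq_iff[THEN iffD2], rule allI)
    fix i
    have "(\<Sum>A\<in>Is. w A *\<^sub>R y A) $ i = (\<Sum>A\<in>Is. if i \<in> A then w A else 0)"
      by (auto simp: y_def intro!: sum.cong)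
    also have "\<dots> = (\<Sum>A\<in>{A. i \<in> A}. w A)"
      using wI by (intro sum.mono_neutral_cong) (auto simp: Is_def)
    also have "\<dots> = x $ i"
      using measure_frac_less[OF nonneg x1] by (simp add: wsum sel_def)
    finally show "x $ i = (\<Sum>A\<in>Is. w A *\<^sub>R y A) $ i" ..
  qed
  also have "\<dots> \<in> STAB E"
    unfolding STAB_def
  proof (intro convex_sum convex_convex_hull one)
    fix A assume "A \<in> Is"
    then show "y A \<in> convex hull {v. (\<forall>i. v $ i \<in> {0, 1}) \<and> (\<forall>i j. E i j \<longrightarrow> v $ i * v $ j = 0)}"
      by (intro hull_inc) (auto simp: y_def Is_def)
  qed (auto simp: w_def)
  finally show ?thesis .
qed

section \<open>Singular antisymmetric matrices\<close>

text \<open>Transposition preserves the determinant, while negation multiplies it by (-1)^n =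
  -1.\<close>

lemma antisym_matrix_singular:
  fixes A :: "real ^ 'n ^ 'n"
  assumes "odd CARD('n)" "transpose A = - A"
  obtains x where "norm x = 1" "A *v x = 0"
proof -
  have "det A = det (transpose A)" by simp
  also have "transpose A = (\<chi> i. - 1 *s A $ i)"
    by (simp add: assms(2) vec_eq_iff)
  also have "det \<dots> = - det A"
    unfolding det_rows_mul using assms(1) by simp
  finally have "det A = 0" by simp
  then have "\<not> invertible A" by (simp add: invertible_det_nz)
  then obtain x where x: "x \<noteq> 0" "A *v x = 0"
    by (metis invertible_left_inverse matrix_left_invertible_ker)
  show thesis
  proof
    show "norm (x /\<^sub>R norm x) = 1" using x by simp
    show "A *v (x /\<^sub>R norm x) = 0" using x by (simp add: matrix_vector_mult_scaleR)
  qed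
qed

text \<open>The imaginary part of \<open>G\<close> is an antisymmetric real matrix of operator norm at most \<open>d\<close>; having
  a nontrivial kernel, its squared Frobenius norm is at most \<open>(n - 1) d\<^sup>2\<close>.\<close>

lemma imaginary_gram_frobenius_le:
  fixes G :: "'n::finite \<Rightarrow> 'n \<Rightarrow> complex"
  assumes odd: "odd CARD('n)"
    and herm: "\<And>i j. G j i = cnj (G i j)"
    and diag: "\<And>i. G i i = complex_of_real d"
    and offdiag: "\<And>i j. i \<noteq> j \<Longrightarrow> Re (G i j) = 0"
    and pos: "\<And>c. 0 \<le> Re (\<Sum>i\<in>UNIV. \<Sum>j\<in>UNIV. cnj (c i) * c j * G i j)"
  shows "sqrt (\<Sum>i\<in>UNIV. \<Sum>j\<in>UNIV. (Im (G i j))\<^sup>2) \<le> sqrt (real CARD('n) - 1) * d"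
proof -
  define A :: "real ^ 'n ^ 'n" where "A = (\<chi> i j. Im (G i j))"
  have anti: "Im (G i j) = - Im (G j i)" for i j
    by (subst herm) simp
  \<comment> \<open>Positivity is tested at c = a + i b: the real part of \<open>G\<close> enters
    through its diagonal only, the imaginary part through an antisymmetric bilinear form.\<close>
  have form: "2 * (a \<bullet> (A *v b)) \<le> d * ((norm a)\<^sup>2 + (norm b)\<^sup>2)" for a b :: "real ^ 'n"
  proof -
    define c where "c i = Complex (a $ i) (b $ i)" for i
    have pt: "Re (cnj (c i) * c j * G i j) =
        (if i = j then d * ((a $ i)\<^sup>2 + (b $ i)\<^sup>2) else 0)
        - a $ i * b $ j * Im (G i j) + b $ i * a $ j * Im (G i j)" for i j
      using offdiag[of i j] diag[of i] by (auto simp: c_def algebra_simps power2_eq_square)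
    have "(\<Sum>i\<in>UNIV. \<Sum>j\<in>UNIV. b $ i * a $ j * Im (G i j)) = (\<Sum>j\<in>UNIV. \<Sum>i\<in>UNIV. b $ i * a $ j * Im (G i j))"
      by (rule sum.swap)
    also have "\<dots> = (\<Sum>j\<in>UNIV. \<Sum>i\<in>UNIV. - (a $ j * b $ i * Im (G j i)))"
      by (intro sum.cong refl) (subst anti, simp)
    finally have sw: "(\<Sum>i\<in>UNIV. \<Sum>j\<in>UNIV. b $ i * a $ j * Im (G i j))
        = - (\<Sum>i\<in>UNIV. \<Sum>j\<in>UNIV. a $ i * b $ j * Im (G i j))"
      by (simp add: sum_negf)
    have "0 \<le> Re (\<Sum>i\<in>UNIV. \<Sum>j\<in>UNIV. cnj (c i) * c j * G i j)" by (rule pos)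
    also have "\<dots> = (\<Sum>i\<in>UNIV. d * ((a $ i)\<^sup>2 + (b $ i)\<^sup>2)) - 2 * (\<Sum>i\<in>UNIV. \<Sum>j\<in>UNIV. a $ i * b $ j * Im (G i j))"
      unfolding Re_sum pt sum.distrib sum_subtractf sw by simp
    also have "(\<Sum>i\<in>UNIV. d * ((a $ i)\<^sup>2 + (b $ i)\<^sup>2)) = d * ((norm a)\<^sup>2 + (norm b)\<^sup>2)"
      unfolding power2_norm_eq_inner inner_vec_def
      by (simp add: sum_distrib_left[symmetric] sum.distrib power2_eq_square)
    also have "(\<Sum>i\<in>UNIV. \<Sum>j\<in>UNIV. a $ i * b $ j * Im (G i j)) = a \<bullet> (A *v b)"
      unfolding inner_vec_def matrix_vector_mult_def A_def
      by (simp add: sum_distrib_left mult_ac)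
    finally show ?thesis by simp
  qed
  have d: "0 \<le> d"
    using form[of 0 "axis undefined 1"] by simp
  have bound: "(norm (A *v b))\<^sup>2 \<le> d\<^sup>2 * (norm b)\<^sup>2" for b
  proof (cases "d = 0")
    case True
    then show ?thesis using form[of "A *v b" b] by (simp add: power2_norm_eq_inner)
  next
    case False
    then have "0 < d" using d by simp
    \<comment> \<open>The choice a = A b / d maximises 2 a . (A b) - d |a|^2.\<close>
    have "2 * ((norm (A *v b))\<^sup>2 / d) \<le> (norm (A *v b))\<^sup>2 / d + d * (norm b)\<^sup>2"
      using form[of "(1 / d) *\<^sub>R (A *v b)" b] \<open>0 < d\<close>
      by (simp add: power2_norm_eq_inner[symmetric] power_divide) (simp add: field_simps power2_eq_square)
    then show ?thesis using \<open>0 < d\<close> by (simp add: field_simps power2_eq_square)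
  qed
  have "transpose A = - A"
    by (simp add: vec_eq_iff transpose_def A_def) (metis anti)
  with odd obtain x where x: "norm x = 1" "A *v x = 0"
    by (rule antisym_matrix_singular)
  \<comment> \<open>As A x = 0, column i is also the image of the projection of the i-th unit vector
    to the complement of x. These projections have squared norms 1 - x_i^2, which add up to n -
    1.\<close>
  have col: "(\<Sum>j\<in>UNIV. (Im (G j i))\<^sup>2) \<le> d\<^sup>2 * (1 - (x $ i)\<^sup>2)" for i
  proof -
    define y where "y = axis i 1 - (x $ i) *\<^sub>R x"
    have "A *v y = A *v axis i 1"
      by (simp add: y_def matrix_vector_mult_diff_distrib matrix_vector_mult_scaleR x)
    also have "\<dots> = (\<chi> j. Im (G j i))"
      by (simp add: vec_eq_iff matrix_vector_mul_component A_def inner_axis)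
    finally have "(norm (A *v y))\<^sup>2 = (\<Sum>j\<in>UNIV. (Im (G j i))\<^sup>2)"
      unfolding power2_norm_eq_inner inner_vec_def by (simp add: power2_eq_square)
    moreover have "(norm y)\<^sup>2 = 1 - (x $ i)\<^sup>2"
    proof -
      have "x \<bullet> x = 1" using x(1) by (simp add: power2_norm_eq_inner[symmetric])
      moreover have "axis i 1 \<bullet> x = x $ i" "x \<bullet> axis i 1 = x $ i"
        by (simp_all add: inner_axis inner_axis')
      moreover have "(axis i 1 :: real ^ 'n) \<bullet> axis i 1 = 1" by (simp add: inner_axis)
      ultimately show ?thesis
        unfolding y_def power2_norm_eq_inner by (simp add: inner_diff_left inner_diff_right power2_eq_square)
    qed
    ultimately show ?thesis using bound[of y] by simp
  qed
  have "(\<Sum>i\<in>UNIV. \<Sum>j\<in>UNIV. (Im (G i j))\<^sup>2) = (\<Sum>i\<in>UNIV. \<Sum>j\<in>UNIV. (Im (G j i))\<^sup>2)"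
    by (rule sum.swap)
  also have "\<dots> \<le> (\<Sum>i\<in>UNIV. d\<^sup>2 * (1 - (x $ i)\<^sup>2))"
    by (intro sum_mono col)
  also have "\<dots> = d\<^sup>2 * (real CARD('n) - (\<Sum>i\<in>UNIV. (x $ i)\<^sup>2))"
    by (simp add: sum_distrib_left[symmetric] sum_subtractf)
  also have "(\<Sum>i\<in>UNIV. (x $ i)\<^sup>2) = (norm x)\<^sup>2"
    unfolding power2_norm_eq_inner inner_vec_def by (simp add: power2_eq_square)
  finally have "(\<Sum>i\<in>UNIV. \<Sum>j\<in>UNIV. (Im (G i j))\<^sup>2) \<le> (real CARD('n) - 1) * d\<^sup>2"
    using x by (simp add: mult.commute)
  from real_sqrt_le_mono[OF this] show ?thesis using d by (simp add: real_sqrt_mult)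
qed

section \<open>Gram functionals on words\<close>

text \<open>\<open>F u w\<close> plays the role of the trace of (adjoint of S_u) rho S_w, where S_u
  is the product of the generators along \<open>u\<close>. The known traces enter in
  \<open>unit\<close> and \<open>expectation\<close>, conjugated by an arbitrary word, because a
  trace may be evaluated in the basis rotated by that word.\<close>

locale word_gram =
  fixes E :: "'n \<Rightarrow> 'n \<Rightarrow> bool" and t :: "'n \<Rightarrow> real" and F :: "'n list \<Rightarrow> 'n list \<Rightarrow> complex"
  assumes herm: "F w u = cnj (F u w)"
    and pos: "0 \<le> Re (\<Sum>p<(n::nat). \<Sum>q<n. cnj (c p) * c q * F (y p) (y q))"
    and unit: "F w w = 1"
    and expectation: "F w (j # w) = complex_of_real (t j)"
    and cancel: "F u (a @ [i, i] @ b) = F u (a @ b)"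
    and swap: "F u (a @ [i, j] @ b) = (if E i j then - 1 else 1) * F u (a @ [j, i] @ b)"
begin

lemma cancel_left: "F (a @ [i, i] @ b) u = F (a @ b) u"
  using cancel herm by metis

lemma swap_left: "F (a @ [i, j] @ b) u = (if E i j then - 1 else 1) * F (a @ [j, i] @ b) u"
  by (subst (1 2) herm, subst swap) simp

end

definition avg_right :: "'n \<Rightarrow> ('n list \<Rightarrow> 'n list \<Rightarrow> complex) \<Rightarrow> 'n list \<Rightarrow> 'n list \<Rightarrow> complex" where
  "avg_right k F u w = (F u w + F (u @ [k]) (w @ [k])) / 2"

lemma word_gram_avg_right:
  assumes "word_gram E t F"
  shows "word_gram E t (avg_right k F)"
proof -
  interpret word_gram E t F by fact
  show ?thesis
  proof
    show "avg_right k F w u = cnj (avg_right k F u w)" for w u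
      using herm[of w u] herm[of "w @ [k]" "u @ [k]"] by (simp add: avg_right_def)
    show "0 \<le> Re (\<Sum>p<(n::nat). \<Sum>q<n. cnj (c p) * c q * avg_right k F (y p) (y q))" for n c y
    proof -
      have eq: "(\<Sum>p<n. \<Sum>q<n. cnj (c p) * c q * avg_right k F (y p) (y q))
        = ((\<Sum>p<n. \<Sum>q<n. cnj (c p) * c q * F (y p) (y q))
          + (\<Sum>p<n. \<Sum>q<n. cnj (c p) * c q * F (y p @ [k]) (y q @ [k]))) / 2" (is "_ = (?X + ?Y) / 2")
        by (simp add: avg_right_def sum.distrib[symmetric] sum_divide_distrib distrib_left add_divide_distrib)
      have "0 \<le> Re ?X" "0 \<le> Re ?Y"
        by (rule pos)+
      then have "0 \<le> Re ((?X + ?Y) / 2)" by (simp del: Re_sum)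
      with eq show ?thesis by (simp only:)
    qed
    show "avg_right k F w w = 1" for w
      by (simp add: avg_right_def unit)
    show "avg_right k F w (j # w) = complex_of_real (t j)" for w j
      using expectation[of "w @ [k]"] by (simp add: avg_right_def expectation)
    show "avg_right k F u (a @ [i, i] @ b) = avg_right k F u (a @ b)" for u a i b
      using cancel[of _ a i b] cancel[of _ a i "b @ [k]"] by (simp add: avg_right_def)
    show "avg_right k F u (a @ [i, j] @ b) = (if E i j then - 1 else 1) * avg_right k F u (a @ [j, i] @ b)"
      for u a i j b
      using swap[of _ a i j b] swap[of _ a i j "b @ [k]"] by (simp add: avg_right_def)
  qed
qed

text \<open>Averaging over right multiplication by each generator in turn replaces the independence of the
  trace from the choice of the basis, which is not available for products of the generators.\<close>

lemma word_gram_right_invariant: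
  fixes E :: "'n::finite \<Rightarrow> 'n \<Rightarrow> bool"
  assumes "word_gram E t F"
  obtains F' where "word_gram E t F'" "\<And>u w i. F' (u @ [i]) (w @ [i]) = F' u w"
proof -
  have "\<exists>F'. word_gram E t F' \<and> (\<forall>u w. \<forall>i\<in>K. F' (u @ [i]) (w @ [i]) = F' u w)" for K :: "'n set"
    using finite[of K]
  proof induction
    case empty
    then show ?case using assms by auto
  next
    case (insert k K)
    then obtain F' where F': "word_gram E t F'" "\<And>u w i. i \<in> K \<Longrightarrow> F' (u @ [i]) (w @ [i]) = F' u w"
      by auto
    interpret word_gram E t F' by fact
    \<comment> \<open>Appending \<open>k\<close> twice cancels, so right multiplication by
      \<open>k\<close> merely exchanges the two summands.\<close>
    have "avg_right k F' (u @ [k]) (w @ [k]) = avg_right k F' u w" for u w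
      using cancel[of _ w k "[]"] cancel_left[of u k "[]"] by (simp add: avg_right_def)
    \<comment> \<open>Exchanging \<open>i\<close> and \<open>k\<close> costs the same sign in both
      arguments, so the invariances obtained earlier survive.\<close>
    moreover have "avg_right k F' (u @ [i]) (w @ [i]) = avg_right k F' u w" if "i \<in> K" for u w i
      using swap[of _ w i k "[]"] swap_left[of u i k "[]"] F'(2)[OF that] F'(2)[OF that, of "u @ [k]" "w @ [k]"]
      by (simp add: avg_right_def)
    ultimately show ?case
      using word_gram_avg_right[OF F'(1), of k] by (intro exI[of _ "avg_right k F'"]) auto
  qed
  from this[of UNIV] that show thesis by blast
qed

text \<open>The new axiom expresses cyclicity of the trace: the generator S_i at the right end moves
  around and cancels against the one from the adjoint.\<close>

locale invariant_word_gram = word_gram +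
  assumes invariant: "F (u @ [i]) (w @ [i]) = F u w"
begin

lemma invariant_append: "F (u @ z) (w @ z) = F u w"
proof (induction z arbitrary: u w)
  case (Cons i z)
  show ?case using Cons[of "u @ [i]" "w @ [i]"] by (simp add: invariant)
qed simp

text \<open>Anticommutation makes \<open>F [i] [j]\<close> imaginary, so the words
  \<open>[i]\<close> and \<open>[j]\<close> are orthonormal over the reals and this is Bessel's
  inequality for \<open>[]\<close>. The coefficients \<open>c\<close> below form the residual of
  \<open>[]\<close> after its projections are subtracted.\<close>

lemma edge_bound:
  assumes "E i j" "E j i"
  shows "(t i)\<^sup>2 + (t j)\<^sup>2 \<le> 1"
proof -
  have "F [i] [j] = F [] [j, i]"
    using invariant[of "[i]" i "[j]"] cancel_left[of "[]" i "[]"] by simp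
  also have "\<dots> = - F [] [i, j]"
    using swap[of "[]" "[]" j i "[]"] assms by simp
  also have "F [] [i, j] = F [j] [i]"
    using invariant[of "[j]" j "[i]"] cancel_left[of "[]" j "[]"] by simp
  also have "\<dots> = cnj (F [i] [j])" by (rule herm)
  finally have im: "Re (F [i] [j]) = 0" by (simp add: complex_eq_iff)
  have ji: "F [j] [i] = cnj (F [i] [j])" by (rule herm)
  have e: "F [] [k] = complex_of_real (t k)" "F [k] [] = complex_of_real (t k)" for k
    using expectation[of "[]" k] by (simp_all add: herm[of "[k]" "[]"])
  define c where "c p = (if p = 0 then 1 else if p = 1 then - complex_of_real (t i) else - complex_of_real (t j))" for p :: nat
  define y where "y p = (if p = 0 then [] else if p = 1 then [i] else [j])" for p :: nat
  have "0 \<le> Re (\<Sum>p<3. \<Sum>q<3. cnj (c p) * c q * F (y p) (y q))" by (rule pos)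
  also have "\<dots> = 1 - (t i)\<^sup>2 - (t j)\<^sup>2"
    by (simp add: eval_nat_numeral c_def y_def unit e im ji)
  finally show ?thesis by simp
qed

text \<open>Equality of two operator products up to the scalar \<open>s\<close>, as far as
  \<open>F\<close> observes it. Quantifying over the contexts \<open>a\<close> and \<open>b\<close>
  makes it a congruence, so that words can be rewritten without forming a quotient algebra.\<close>

definition wrel :: "complex \<Rightarrow> 'a list \<Rightarrow> 'a list \<Rightarrow> bool" where
  "wrel s w w' \<longleftrightarrow> (\<forall>u a b. F u (a @ w @ b) = s * F u (a @ w' @ b))"

lemma wrelD: "wrel s w w' \<Longrightarrow> F u (a @ w @ b) = s * F u (a @ w' @ b)"
  by (simp add: wrel_def)

lemma wrel_refl: "wrel 1 w w"
  by (simp add: wrel_def)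

lemma wrel_trans: "wrel s w w' \<Longrightarrow> wrel r w' w'' \<Longrightarrow> wrel (s * r) w w''"
  by (simp add: wrel_def)

lemma wrel_context: "wrel s w w' \<Longrightarrow> wrel s (a @ w @ b) (a @ w' @ b)"
  unfolding wrel_def by (metis append.assoc)

lemma wrel_cancel: "wrel 1 (i # i # w) w"
  using cancel[of _ _ i "w @ _"] by (simp add: wrel_def)

lemma wrel_move:
  "wrel (\<Prod>b\<leftarrow>w. if E a b then - 1 else 1) (a # w) (w @ [a])"
proof (induction w)
  case Nil
  then show ?case by (simp add: wrel_refl)
next
  case (Cons b w)
  have "wrel (if E a b then - 1 else 1) (a # b # w) (b # a # w)"
    using swap[of _ _ a b "w @ _"] by (simp add: wrel_def)
  moreover have "wrel (\<Prod>b\<leftarrow>w. if E a b then - 1 else 1) (b # a # w) (b # w @ [a])"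
    using wrel_context[OF Cons, of "[b]" "[]"] by simp
  ultimately show ?case using wrel_trans by fastforce
qed

text \<open>A unitary with square s = 1 or s = -1 equals s times its adjoint, so its expectation is
  real or imaginary accordingly.\<close>

lemma gram_involution:
  assumes "wrel s (w @ w) []"
  shows "F [] w = s * cnj (F [] w)"
proof -
  have "F [] w = F w (w @ w)"
    using invariant_append[of "[]" w w] by simp
  also have "\<dots> = s * F w []" using wrelD[OF assms, of w "[]" "[]"] by simp
  finally show ?thesis by (subst (asm) (2) herm)
qed

end

lemma mod_add_left_cancel_nat: "(j + i) mod m = (j + k) mod m \<longleftrightarrow> i mod m = k mod (m::nat)"
proof (induction i k rule: linorder_wlog)
  case (le i k)
  then show ?case
    using mod_eq_dvd_iff_nat[of i k m] mod_eq_dvd_iff_nat[of "j + i" "j + k" m] by auto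
qed auto

text \<open>Here \<open>E i\<close> stands for adjacency of the vertices i and l. The predecessor l
  - 1 always contributes a factor -1; vertex 0 contributes a second one exactly when l closes the
  cycle.\<close>

lemma prod_path_signs:
  fixes E :: "nat \<Rightarrow> bool"
  assumes m: "3 \<le> m" and l: "0 < l" "l < m"
    and E: "\<And>i. i < l \<Longrightarrow> E i \<longleftrightarrow> i + 1 = l \<or> i + m = l + 1"
  shows "(\<Prod>i<l. if E i then - 1 else (1::complex)) = (if l = m - 1 then 1 else - 1)"
proof (cases "l = m - 1")
  case True
  then have *: "{..<l} = insert 0 (insert (l - 1) {1..<l-1})" using m by auto
  have "(\<Prod>i\<in>{1..<l-1}. if E i then - 1 else (1::complex)) = 1"
    by (rule prod.neutral) (use E True in auto)
  moreover have "E 0" "E (l - 1)" "l - 1 \<noteq> 0"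
    using E[of 0] E[of "l - 1"] True m by auto
  ultimately show ?thesis using True unfolding * by simp
next
  case False
  then have *: "{..<l} = insert (l - 1) {..<l-1}" using l by auto
  have "(\<Prod>i\<in>{..<l-1}. if E i then - 1 else (1::complex)) = 1"
    by (rule prod.neutral) (use E False l in auto)
  then show ?thesis using False E[of "l - 1"] l unfolding * by simp
qed

section \<open>Words of consecutive generators and Majorana covariances on an odd cycle\<close>

locale cycle_word_gram = invariant_word_gram E t F
  for E :: "'n::finite \<Rightarrow> 'n \<Rightarrow> bool" and t F +
  fixes v :: "nat \<Rightarrow> 'n" and m :: nat
  assumes m: "3 \<le> m" "odd m"
    and v: "bij_betw v {..<m} UNIV"
    and adj: "\<forall>i<m. \<forall>j<m. E (v i) (v j) \<longleftrightarrow> j = (i + 1) mod m \<or> i = (j + 1) mod m"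
begin

text \<open>In Majorana terms this product telescopes to gamma_j gamma_{j+l} up to a phase. The
  newest letter comes first, so that \<open>seg 0 j\<close> is a suffix of
  \<open>seg 0 (j + l)\<close> and right invariance can remove it.\<close>

fun seg :: "nat \<Rightarrow> nat \<Rightarrow> 'n list" where
  "seg j 0 = []"
| "seg j (Suc l) = v ((j + l) mod m) # seg j l"

lemma seg_add: "seg j (k + l) = seg (j + k) l @ seg j k"
  by (induction l) (auto simp: add.assoc)

lemma seg_shift: "seg (j + m) l = seg j l"
proof (induction l)
  case (Suc l)
  have "(j + m + l) mod m = (j + l) mod m" by (metis add.assoc add.commute mod_add_self2)
  then show ?case using Suc by simp
qed simp

lemma prod_list_seg: "(\<Prod>b\<leftarrow>seg j l. f b) = (\<Prod>i<l. f (v ((j + i) mod m)) :: complex)"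
  by (induction l) (simp_all add: mult.commute)

lemma adj_mod:
  assumes "i < l" "l < m"
  shows "E (v ((j + l) mod m)) (v ((j + i) mod m)) \<longleftrightarrow> i + 1 = l \<or> i + m = l + 1"
proof -
  have "E (v ((j + l) mod m)) (v ((j + i) mod m)) \<longleftrightarrow>
      (j + i) mod m = (j + l + 1) mod m \<or> (j + l) mod m = (j + i + 1) mod m"
    using m adj by (simp add: mod_Suc_eq)
  also have "(j + i) mod m = (j + l + 1) mod m \<longleftrightarrow> i + m = l + 1"
  proof -
    have "(j + i) mod m = (j + l + 1) mod m \<longleftrightarrow> i mod m = (l + 1) mod m"
      using mod_add_left_cancel_nat[of j i m "l + 1"] by (simp add: add.assoc)
    then show ?thesis using assms by (auto simp: mod_Suc)
  qed
  also have "(j + l) mod m = (j + i + 1) mod m \<longleftrightarrow> i + 1 = l"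
  proof -
    have "(j + l) mod m = (j + i + 1) mod m \<longleftrightarrow> l mod m = (i + 1) mod m"
      using mod_add_left_cancel_nat[of j l m "i + 1"] by (simp add: add.assoc)
    then show ?thesis using assms by (auto simp: mod_Suc)
  qed
  finally show ?thesis by blast
qed

lemma move_seg:
  assumes "0 < l" "l < m"
  shows "wrel (if l = m - 1 then 1 else - 1) (v ((j + l) mod m) # seg j l) (seg j l @ [v ((j + l) mod m)])"
proof -
  have "(\<Prod>b\<leftarrow>seg j l. if E (v ((j + l) mod m)) b then - 1 else 1) = (if l = m - 1 then 1 else - 1 :: complex)"
    unfolding prod_list_seg
    using assms m by (intro prod_path_signs adj_mod) auto
  then show ?thesis using wrel_move[of "v ((j + l) mod m)" "seg j l"] by simp
qed

text \<open>A new letter anticommutes with the word so far, since on a proper path it has one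
  neighbour there. Hence each extension flips the sign of the square, which is +1 at length
  1.\<close>

lemma seg_square:
  assumes "0 < l" "l < m"
  shows "wrel ((- 1) ^ (l + 1)) (seg j l @ seg j l) []"
  using assms
proof (induction l)
  case (Suc l)
  let ?a = "v ((j + l) mod m)"
  show ?case
  proof (cases "l = 0")
    case True
    then show ?thesis using wrel_cancel[of ?a "[]"] by simp
  next
    case False
    have "wrel (- 1) (?a # seg j l) (seg j l @ [?a])"
      using move_seg[of l j] False Suc.prems by (auto split: if_splits)
    from wrel_context[OF this, of "[]" "?a # seg j l"]
    have "wrel (- 1) (seg j (Suc l) @ seg j (Suc l)) (seg j l @ [?a, ?a] @ seg j l)" by simp
    moreover have "wrel 1 (seg j l @ [?a, ?a] @ seg j l) (seg j l @ seg j l)"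
      using wrel_context[OF wrel_cancel[of ?a "[]"], of "seg j l" "seg j l"] by simp
    moreover have "wrel ((- 1) ^ (l + 1)) (seg j l @ seg j l) []"
      using Suc False by simp
    ultimately have "wrel (- 1 * (1 * (- 1) ^ (l + 1))) (seg j (Suc l) @ seg j (Suc l)) []"
      by (metis wrel_trans)
    then show ?thesis by simp
  qed
qed simp

text \<open>The last letter has two neighbours in the rest and commutes with it, so the square keeps
  the value (-1)^m = -1 from length m - 1. Thus \<open>\<i>\<close> times the full product is the
  central involution, called Z below.\<close>

lemma full_square: "wrel (- 1) (seg j m @ seg j m) []"
proof -
  obtain l where l: "m = Suc l" "l > 0" using m by (cases m) auto
  let ?a = "v ((j + l) mod m)"
  have "wrel 1 (?a # seg j l) (seg j l @ [?a])"
    using move_seg[of l j] l by simp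
  moreover have "seg j m = ?a # seg j l" by (metis l(1) seg.simps(2))
  ultimately have "wrel 1 (seg j m @ seg j m) (seg j l @ [?a, ?a] @ seg j l)"
    using wrel_context[of 1 "?a # seg j l" "seg j l @ [?a]" "[]" "?a # seg j l"] by simp
  moreover have "wrel 1 (seg j l @ [?a, ?a] @ seg j l) (seg j l @ seg j l)"
    using wrel_context[OF wrel_cancel[of ?a "[]"], of "seg j l" "seg j l"] by simp
  moreover have "wrel (- 1) (seg j l @ seg j l) []"
    using seg_square[of l j] m l by simp
  ultimately have "wrel (1 * (1 * - 1)) (seg j m @ seg j m) []"
    by (metis wrel_trans)
  then show ?thesis by simp
qed

text \<open>The leading letter commutes with the remaining m - 1 letters and can be moved to the
  end, which rotates the word.\<close>

lemma full_shift: "F [] (seg j m) = F [] (seg 0 m)"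
proof (induction j)
  case (Suc j)
  obtain l where l: "m = Suc l" "l > 0" using m by (cases m) auto
  have "Suc j + l = j + m" by (simp add: l)
  then have j: "(Suc j + l) mod m = j mod m" by (metis mod_add_self2)
  have "wrel 1 (v (j mod m) # seg (Suc j) l) (seg (Suc j) l @ [v (j mod m)])"
    using move_seg[of l "Suc j"] l j by simp
  moreover have "seg (Suc j) m = v (j mod m) # seg (Suc j) l"
    using j by (metis l(1) seg.simps(2))
  moreover have "seg j m = seg (Suc j) l @ [v (j mod m)]"
  proof -
    have "seg j (1 + l) = seg (Suc j) l @ [v (j mod m)]" unfolding seg_add by simp
    then show ?thesis using l(1) by simp
  qed
  ultimately have "wrel 1 (seg (Suc j) m) (seg j m)" by simp
  then show ?case using Suc wrelD[of 1 "seg (Suc j) m" "seg j m" "[]" "[]" "[]"] by simp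
qed simp

text \<open>\<open>Gam j k\<close> is the covariance of Majorana operators \<open>\<gamma>\<^sub>j\<close> and \<open>\<gamma>\<^sub>k\<close> with
  \<open>S (v j) = \<plusminus> \<i> \<gamma>\<^sub>j \<gamma>\<^sub>j\<^sub>+\<^sub>1\<close>, except that \<open>\<gamma>\<^sub>j\<^sub>+\<^sub>m\<close> is \<open>\<gamma>\<^sub>j\<close> times a central involution.\<close>

definition Gam :: "nat \<Rightarrow> nat \<Rightarrow> complex" where
  "Gam j k = cnj (\<i> ^ j) * \<i> ^ k * F (seg 0 j) (seg 0 k)"

lemma cnj_i_power: "cnj (\<i> ^ j) * \<i> ^ j = 1"
  by (simp add: power_mult_distrib[symmetric])

lemma Gam_herm: "Gam k j = cnj (Gam j k)"
  unfolding Gam_def by (subst herm) simp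

lemma Gam_diff: "Gam j (j + l) = \<i> ^ l * F [] (seg j l)"
proof -
  have "Gam j (j + l) = (cnj (\<i> ^ j) * \<i> ^ j) * (\<i> ^ l * F (seg 0 j) (seg 0 (j + l)))"
    by (simp add: Gam_def power_add)
  also have "F (seg 0 j) (seg 0 (j + l)) = F [] (seg j l)"
    using invariant_append[of "[]" "seg 0 j" "seg j l"] by (simp add: seg_add)
  finally show ?thesis unfolding cnj_i_power by simp
qed

lemma Gam_shift: "Gam (j + m) (k + m) = Gam j k"
proof -
  have "Gam (j + m) (k + m) = (cnj (\<i> ^ m) * \<i> ^ m) * (cnj (\<i> ^ j) * \<i> ^ k * F (seg 0 (m + j)) (seg 0 (m + k)))"
    by (simp add: Gam_def power_add add.commute)
  also have "F (seg 0 (m + j)) (seg 0 (m + k)) = F (seg 0 j) (seg 0 k)"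
    unfolding seg_add using seg_shift[of 0] by (simp add: invariant_append)
  finally show ?thesis unfolding cnj_i_power by (simp add: Gam_def)
qed

lemma Gam_period: "Gam j (k + m + m) = Gam j k"
proof -
  have "\<i> ^ (m + m) = (\<i> ^ 2) ^ m" by (simp add: power_mult[symmetric] mult_2)
  also have "\<dots> = - 1" using m by simp
  finally have i: "\<i> ^ (m + m) = - 1" .
  have "seg 0 (m + m + k) = seg 0 k @ seg 0 m @ seg 0 m"
    using seg_add[of 0 "m + m" k] seg_add[of 0 m m] seg_shift[of 0] seg_shift[of m k]
    by simp
  then have "F (seg 0 j) (seg 0 (m + m + k)) = - F (seg 0 j) (seg 0 k)"
    using wrelD[OF full_square[of 0], of "seg 0 j" "seg 0 k" "[]"] by simp
  then have "Gam j (m + m + k) = cnj (\<i> ^ j) * \<i> ^ (m + m) * \<i> ^ k * - F (seg 0 j) (seg 0 k)"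
    unfolding Gam_def power_add[of _ "m + m"] by simp
  then show ?thesis unfolding i by (simp add: Gam_def add_ac)
qed

text \<open>The phase \<open>\<i> ^ l\<close> turns the alternating signs of
  \<open>seg_square\<close> into a uniform -1: distinct Majorana operators anticommute.\<close>

lemma Gam_imaginary:
  assumes "0 < l" "l < m"
  shows "Re (Gam j (j + l)) = 0"
proof -
  have "Gam j (j + l) = \<i> ^ l * ((- 1) ^ (l + 1) * cnj (F [] (seg j l)))"
    unfolding Gam_diff using gram_involution[OF seg_square[OF assms]] by (rule arg_cong)
  also have "\<dots> = - cnj (\<i> ^ l * F [] (seg j l))"
    by (simp add: power_minus[of \<i>])
  finally show ?thesis by (simp add: Gam_diff[symmetric] complex_eq_iff)
qed

text \<open>Up to sign, c is the expectation of Z, which is real and does not depend on where the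
  cycle is entered.\<close>

lemma Gam_full:
  obtains c where "\<And>j. Gam j (j + m) = complex_of_real c"
proof -
  have "cnj (\<i> ^ m) = - (\<i> ^ m)" using m by (simp add: power_minus[of \<i>])
  moreover have "cnj (F [] (seg 0 m)) = - F [] (seg 0 m)"
    using arg_cong[OF gram_involution[OF full_square[of 0]], of uminus] by simp
  ultimately have "cnj (Gam 0 (0 + m)) = Gam 0 (0 + m)"
    unfolding Gam_diff complex_cnj_mult by simp
  then have "Im (Gam 0 (0 + m)) = 0"
    by (simp add: complex_eq_iff)
  then obtain c where "Gam 0 (0 + m) = complex_of_real c"
    using complex_eq_iff by force
  then have "Gam j (j + m) = complex_of_real c" for j
    unfolding Gam_diff using full_shift[of j] by simp
  then show thesis by (rule that)
qed

lemma Gam_succ: "Gam j (j + 1) = \<i> * complex_of_real (t (v (j mod m)))"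
  unfolding Gam_diff using expectation[of "[]"] by simp

lemma Gam_flip: "Gam (j + m) k = Gam j (k + m)"
  using Gam_period[of "j + m" k] Gam_shift[of j "k + m"] by simp

lemma Gam_offdiag:
  assumes "j < m" "k < m" "j \<noteq> k"
  shows "Re (Gam j k) = 0" "Re (Gam j (k + m)) = 0"
proof -
  have lt: "Re (Gam j k) = 0 \<and> Re (Gam j (k + m)) = 0 \<and> Re (Gam k j) = 0 \<and> Re (Gam k (j + m)) = 0"
    if "j < k" "k < m" for j k
  proof -
    have "Re (Gam j k) = 0" using Gam_imaginary[of "k - j" j] that by simp
    moreover have "Re (Gam k (j + m)) = 0" using Gam_imaginary[of "j + m - k" k] that by simp
    ultimately show ?thesis
      using Gam_herm[of k j] Gam_herm[of "k" "j + m"] Gam_flip[of j k] by simp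
  qed
  show "Re (Gam j k) = 0" "Re (Gam j (k + m)) = 0"
    using lt[of j k] lt[of k j] assms by (auto simp: neq_iff)
qed

lemma sum_split: "(\<Sum>p<m + m. h p) = (\<Sum>p<m. h p + h (p + m) :: complex)"
proof -
  have "(\<Sum>p<m + k. h p) = (\<Sum>p<m. h p) + (\<Sum>p<k. h (p + m))" for k
    by (induction k) (auto simp: add_ac)
  then show ?thesis by (simp add: sum.distrib)
qed

text \<open>This is half the Gram matrix of the vectors gamma_p (1 + s Z), because (1 + s Z)^2 = 2
  (1 + s Z); it describes the part of the state on which Z = s. As gamma_{p+m} = gamma_p Z, the
  second half of the coefficients \<open>b\<close> is s times the first.\<close>

lemma twisted_pos:
  fixes s :: real
  assumes "s\<^sup>2 = 1"
  shows "0 \<le> Re (\<Sum>p<m. \<Sum>q<m. cnj (a p) * a q * (Gam p q + s * Gam p (q + m)))"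
proof -
  define b where "b p = (if p < m then a p else s * a (p - m))" for p
  have s: "complex_of_real s * complex_of_real s = 1"
    using assms by (simp flip: of_real_mult add: power2_eq_square)
  have s2: "complex_of_real s * (complex_of_real s * z) = z" for z
    using s by (simp add: mult.assoc[symmetric])
  have "(\<Sum>p<m + m. \<Sum>q<m + m. cnj (b p) * b q * Gam p q)
      = (\<Sum>p<m. \<Sum>q<m. 2 * (cnj (a p) * a q * (Gam p q + s * Gam p (q + m))))"
  proof -
    have "cnj (b p) * b q * Gam p q + cnj (b p) * b (q + m) * Gam p (q + m)
        + (cnj (b (p + m)) * b q * Gam (p + m) q + cnj (b (p + m)) * b (q + m) * Gam (p + m) (q + m))
        = 2 * (cnj (a p) * a q * (Gam p q + s * Gam p (q + m)))" if "p < m" "q < m" for p q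
      using that s s2 unfolding Gam_flip Gam_period by (simp add: b_def algebra_simps)
    then show ?thesis
      unfolding sum_split sum.distrib[symmetric] by (intro sum.cong) auto
  qed
  also have "\<dots> = 2 * (\<Sum>p<m. \<Sum>q<m. cnj (a p) * a q * (Gam p q + s * Gam p (q + m)))"
    by (simp only: sum_distrib_left)
  finally have e: "(\<Sum>p<m + m. \<Sum>q<m + m. cnj (b p) * b q * Gam p q) = \<dots>" .
  have "0 \<le> Re (\<Sum>p<m + m. \<Sum>q<m + m. cnj (b p * \<i> ^ p) * (b q * \<i> ^ q) * F (seg 0 p) (seg 0 q))"
    by (rule pos)
  also have "(\<Sum>p<m + m. \<Sum>q<m + m. cnj (b p * \<i> ^ p) * (b q * \<i> ^ q) * F (seg 0 p) (seg 0 q))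
      = (\<Sum>p<m + m. \<Sum>q<m + m. cnj (b p) * b q * Gam p q)"
    by (simp add: Gam_def mult_ac)
  finally show ?thesis unfolding e by (simp del: Re_sum)
qed

text \<open>The covariance matrix \<open>M\<close> of the part with Z = s has the constant diagonal
  1 + s c, and the summands on the left are its entries for neighbouring indices, up to
  sign.\<close>

lemma twisted_bound:
  fixes s :: real
  assumes s: "s\<^sup>2 = 1" and c: "\<And>j. Gam j (j + m) = complex_of_real c"
  shows "L2_set (\<lambda>j. t (v j) + s * Im (Gam j (j + 1 + m))) {..<m} \<le> sqrt (real (m div 2)) * (1 + s * c)"
proof -
  define M where "M j k = Gam j k + s * Gam j (k + m)" for j k
  define r where "r = the_inv_into {..<m} v"
  have r: "r (v j) = j" if "j < m" for j
    using v that unfolding r_def bij_betw_def by (intro the_inv_into_f_f) auto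
  have rm: "r i < m" "v (r i) = i" for i
    using v unfolding r_def bij_betw_def
    by (auto intro!: f_the_inv_into_f simp: the_inv_into_into[of _ _ _ "{..<m}", simplified])
  have card: "CARD('n) = m" using bij_betw_same_card[OF v] by simp
  have to_nat: "(\<Sum>i\<in>UNIV. \<Sum>k\<in>UNIV. h i k) = (\<Sum>j<m. \<Sum>k<m. h (v j) (v k))" for h :: "'n \<Rightarrow> 'n \<Rightarrow> 'z::comm_monoid_add"
    by (simp add: sum.reindex_bij_betw[OF v, symmetric])
  have 1: "sqrt (\<Sum>i\<in>UNIV. \<Sum>j\<in>UNIV. (Im (M (r i) (r j)))\<^sup>2) \<le> sqrt (real CARD('n) - 1) * (1 + s * c)"
  proof (rule imaginary_gram_frobenius_le)
    show "odd CARD('n)" using card m by simp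
    show "M (r j) (r i) = cnj (M (r i) (r j))" for i j
      using Gam_herm[of "r j" "r i"] Gam_herm[of "r j + m" "r i"] Gam_flip[of "r j" "r i"] by (simp add: M_def)
    show "M (r i) (r i) = complex_of_real (1 + s * c)" for i
      using Gam_diff[of "r i" 0] c[of "r i"] by (simp add: M_def unit)
    show "Re (M (r i) (r j)) = 0" if "i \<noteq> j" for i j
    proof -
      have "r i \<noteq> r j" using that rm(2) by metis
      then show ?thesis using Gam_offdiag[of "r i" "r j"] rm(1) by (simp add: M_def)
    qed
    show "0 \<le> Re (\<Sum>i\<in>UNIV. \<Sum>j\<in>UNIV. cnj (a i) * a j * M (r i) (r j))" for a
      using twisted_pos[OF s, of "a \<circ> v"] unfolding to_nat by (simp add: r M_def del: Re_sum)
  qed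
  define f where "f = (\<lambda>(j, k). (Im (M j k))\<^sup>2)"
  define nx where "nx j = (j + 1) mod m" for j
  have f_sym: "f (j, k) = f (k, j)" for j k
    using Gam_herm[of k j] Gam_herm[of "k + m" j] Gam_flip[of k j] by (simp add: f_def M_def power2_eq_square algebra_simps)
  \<comment> \<open>At j = m - 1 the successor index is 0 instead of m. This costs a factor s, which
    disappears on squaring.\<close>
  have nx: "f (j, nx j) = (t (v j) + s * Im (Gam j (j + 1 + m)))\<^sup>2" if "j < m" for j
  proof (cases "j + 1 < m")
    case True
    then show ?thesis using Gam_succ[of j] that by (simp add: f_def M_def nx_def)
  next
    case False
    then have j: "j + 1 = m" using that by simp
    have "Im (M j (nx j)) = Im (Gam j (j + 1 + m)) + s * t (v j)"
    proof -
      have "nx j = 0" "j + 1 + m = 0 + m + m" using j by (simp_all add: nx_def)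
      moreover have "Gam j (0 + m) = \<i> * complex_of_real (t (v j))"
        using Gam_succ[of j] that j by simp
      ultimately show ?thesis using Gam_period[of j 0] by (simp add: M_def)
    qed
    also have "\<dots> = s * (t (v j) + s * Im (Gam j (j + 1 + m)))"
      using s by (simp add: algebra_simps power2_eq_square)
    finally show ?thesis using s by (simp add: f_def power_mult_distrib)
  qed
  have inj: "inj_on (\<lambda>j. (j, nx j)) {..<m}" "inj_on (\<lambda>j. (nx j, j)) {..<m}"
    by (auto simp: inj_on_def)
  have disj: "(\<lambda>j. (j, nx j)) ` {..<m} \<inter> (\<lambda>j. (nx j, j)) ` {..<m} = {}"
    using m by (auto simp: nx_def mod_Suc split: if_splits)
  \<comment> \<open>By antisymmetry each edge of the cycle occurs twice in the Frobenius norm, in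
    two positions that are distinct because m >= 3; all other entries are dropped.\<close>
  have "2 * (\<Sum>j<m. (t (v j) + s * Im (Gam j (j + 1 + m)))\<^sup>2) = (\<Sum>j<m. f (j, nx j)) + (\<Sum>j<m. f (nx j, j))"
    by (simp add: nx f_sym[of "nx _"])
  also have "\<dots> = sum f ((\<lambda>j. (j, nx j)) ` {..<m} \<union> (\<lambda>j. (nx j, j)) ` {..<m})"
    by (subst sum.union_disjoint) (use disj inj in \<open>auto simp: sum.reindex\<close>)
  also have "\<dots> \<le> sum f ({..<m} \<times> {..<m})"
    using m by (intro sum_mono2) (auto simp: nx_def f_def)
  also have "\<dots> = (\<Sum>i\<in>UNIV. \<Sum>j\<in>UNIV. (Im (M (r i) (r j)))\<^sup>2)"
    unfolding to_nat by (simp add: sum.cartesian_product f_def r)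
  finally have "sqrt 2 * L2_set (\<lambda>j. t (v j) + s * Im (Gam j (j + 1 + m))) {..<m}
      \<le> sqrt (\<Sum>i\<in>UNIV. \<Sum>j\<in>UNIV. (Im (M (r i) (r j)))\<^sup>2)"
    by (simp add: L2_set_def flip: real_sqrt_mult)
  also have "\<dots> \<le> sqrt (2 * real (m div 2)) * (1 + s * c)"
  proof -
    have "real CARD('n) - 1 = 2 * real (m div 2)" using m card by (auto elim!: oddE)
    with 1 show ?thesis by simp
  qed
  finally show ?thesis by (simp add: real_sqrt_mult)
qed

text \<open>Adding the bounds for s = 1 and s = -1 eliminates both the unknown entries
  \<open>u\<close> and the unknown c.\<close>

lemma cycle_bound: "(\<Sum>i\<in>UNIV. (t i)\<^sup>2) \<le> real (m div 2)"
proof -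
  obtain c where c: "\<And>j. Gam j (j + m) = complex_of_real c" using Gam_full by blast
  define u where "u j = Im (Gam j (j + 1 + m))" for j
  have "2 * L2_set (\<lambda>j. t (v j)) {..<m} = L2_set (\<lambda>j. (t (v j) + 1 * u j) + (t (v j) + (- 1) * u j)) {..<m}"
    by (simp add: L2_set_right_distrib)
  also have "\<dots> \<le> L2_set (\<lambda>j. t (v j) + 1 * u j) {..<m} + L2_set (\<lambda>j. t (v j) + (- 1) * u j) {..<m}"
    by (rule L2_set_triangle_ineq)
  also have "\<dots> \<le> sqrt (real (m div 2)) * (1 + 1 * c) + sqrt (real (m div 2)) * (1 + (- 1) * c)"
    unfolding u_def by (intro add_mono twisted_bound c) auto
  also have "\<dots> = 2 * sqrt (real (m div 2))" by (simp add: algebra_simps)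
  finally have "(\<Sum>j<m. (t (v j))\<^sup>2) \<le> real (m div 2)"
    by (simp add: L2_set_def)
  then show ?thesis using sum.reindex_bij_betw[OF v, of "\<lambda>i. (t i)\<^sup>2"] by simp
qed

end

section \<open>Words in a self-adjoint unitary representation\<close>

context complex_hilbert_space
begin

lemma inner_add_left:
  "\<lbrakk>x \<in> hcarrier H; y \<in> hcarrier H; z \<in> hcarrier H\<rbrakk> \<Longrightarrow> hinner H (hadd H x y) z = hinner H x z + hinner H y z"
  by (metis add_closed complex_cnj_add inner_add_right inner_commute)

lemma inner_scale_left:
  "\<lbrakk>x \<in> hcarrier H; y \<in> hcarrier H\<rbrakk> \<Longrightarrow> hinner H (hscale H a x) y = cnj a * hinner H x y"
  by (metis scale_closed complex_cnj_mult inner_scale_right inner_commute)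

lemma inner_zero_right: "x \<in> hcarrier H \<Longrightarrow> hinner H x (hzero H) = 0"
  by (metis add_cancel_right_right add_zero inner_add_right zero_closed)

lemma inner_zero_left: "x \<in> hcarrier H \<Longrightarrow> hinner H (hzero H) x = 0"
  by (metis complex_cnj_zero inner_commute inner_zero_right zero_closed)

lemma inner_self:
  assumes "x \<in> hcarrier H"
  shows "hinner H x x = complex_of_real (Re (hinner H x x))"
  using inner_commute[OF assms assms] by (simp add: complex_eq_iff)

text \<open>A nonzero vector orthogonal to a maximal orthonormal set could be normalised and added.
  The basis is what \<open>density_word_gram\<close> sums over.\<close>

lemma orthonormal_basis_exists: "\<exists>B. orthonormal_basis H B"
proof -
  define ON where "ON = {B. B \<subseteq> hcarrier H \<and> (\<forall>e\<in>B. \<forall>f\<in>B. hinner H e f = (if e = f then 1 else 0))}"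
  have "\<exists>M\<in>ON. \<forall>X\<in>ON. M \<subseteq> X \<longrightarrow> X = M"
  proof (rule subset_Zorn')
    fix C assume C: "subset.chain ON C"
    have "hinner H e f = (if e = f then 1 else 0)" if "e \<in> X" "X \<in> C" "f \<in> Y" "Y \<in> C" for e f X Y
    proof -
      have "X \<subseteq> Y \<or> Y \<subseteq> X" "X \<in> ON" "Y \<in> ON"
        using C that by (auto simp: subset.chain_def)
      then show ?thesis using that unfolding ON_def by blast
    qed
    moreover have "\<Union>C \<subseteq> hcarrier H"
      using C by (auto simp: subset.chain_def ON_def)
    ultimately show "\<Union>C \<in> ON" by (auto simp: ON_def)
  qed
  then obtain M where M: "M \<in> ON" "\<And>X. X \<in> ON \<Longrightarrow> M \<subseteq> X \<Longrightarrow> X = M" by blast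
  have "x = hzero H" if x: "x \<in> hcarrier H" and orth: "\<And>e. e \<in> M \<Longrightarrow> hinner H e x = 0" for x
  proof (rule ccontr)
    assume nz: "x \<noteq> hzero H"
    define r where "r = Re (hinner H x x)"
    have r: "hinner H x x = complex_of_real r" using inner_self[OF x] by (simp add: r_def)
    have "r \<noteq> 0" using inner_definite[OF x] nz r by auto
    with inner_nonneg[OF x] have "0 < r" by (simp add: r_def)
    define c where "c = complex_of_real (1 / sqrt r)"
    define y where "y = hscale H c x"
    have y: "y \<in> hcarrier H" by (simp add: y_def scale_closed x)
    have "c * c * complex_of_real r = complex_of_real (1 / sqrt r * (1 / sqrt r) * r)"
      unfolding c_def by (simp only: of_real_mult)
    also have "1 / sqrt r * (1 / sqrt r) * r = 1" using \<open>0 < r\<close> by (simp add: field_simps)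
    finally have yy: "hinner H y y = 1"
      using x y unfolding y_def by (simp add: inner_scale_left inner_scale_right scale_closed r) (simp add: c_def mult.assoc)
    have ey: "hinner H e y = 0" "hinner H y e = 0" if "e \<in> M" for e
    proof -
      have e: "e \<in> hcarrier H" using that M(1) by (auto simp: ON_def)
      show "hinner H e y = 0" by (simp add: y_def inner_scale_right e x orth[OF that])
      then show "hinner H y e = 0" using inner_commute[OF e y] by simp
    qed
    have "insert y M \<in> ON"
      using M(1) y yy ey by (auto simp: ON_def)
    then have "y \<in> M" using M(2) by blast
    then show False using ey(1) yy by simp
  qed
  moreover have "M \<subseteq> hcarrier H" "\<forall>e\<in>M. \<forall>f\<in>M. hinner H e f = (if e = f then 1 else 0)"
    using M(1) unfolding ON_def by blast+
  ultimately have "orthonormal_basis H M"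
    unfolding orthonormal_basis_def by blast
  then show ?thesis ..
qed

end

locale hilbert_saur = complex_hilbert_space H for H :: "'v hspace" +
  fixes E :: "'n \<Rightarrow> 'n \<Rightarrow> bool" and S :: "'n \<Rightarrow> 'v \<Rightarrow> 'v"
  assumes saur: "SAUR H E S"
begin

lemma S_closed: "x \<in> hcarrier H \<Longrightarrow> S i x \<in> hcarrier H"
  and S_scale: "x \<in> hcarrier H \<Longrightarrow> S i (hscale H c x) = hscale H c (S i x)"
  and S_adjoint: "x \<in> hcarrier H \<Longrightarrow> y \<in> hcarrier H \<Longrightarrow> hinner H (S i x) y = hinner H x (S i y)"
  and S_square: "x \<in> hcarrier H \<Longrightarrow> S i (S i x) = x"
  using saur unfolding SAUR_def self_adjoint_operator_def bounded_operator_def by auto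

lemma S_swap:
  assumes "x \<in> hcarrier H"
  shows "S i (S j x) = hscale H (if E i j then - 1 else 1) (S j (S i x))"
proof (cases "E i j")
  case True
  then show ?thesis using saur assms by (simp add: SAUR_def)
next
  case False
  then have "S i (S j x) = S j (S i x)" using saur assms unfolding SAUR_def by blast
  with False show ?thesis using assms by (simp add: scale_one S_closed)
qed

abbreviation word :: "'n list \<Rightarrow> 'v \<Rightarrow> 'v" where
  "word \<equiv> foldr S"

lemma word_closed: "x \<in> hcarrier H \<Longrightarrow> word w x \<in> hcarrier H"
  by (induction w) (auto simp: S_closed)

lemma word_scale: "x \<in> hcarrier H \<Longrightarrow> word w (hscale H c x) = hscale H c (word w x)"
  by (induction w) (auto simp: S_scale word_closed)

lemma word_adjoint:
  "x \<in> hcarrier H \<Longrightarrow> y \<in> hcarrier H \<Longrightarrow> hinner H (word w x) y = hinner H x (word (rev w) y)"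
  by (induction w arbitrary: y) (auto simp: S_adjoint S_closed word_closed)

lemma word_rev: "x \<in> hcarrier H \<Longrightarrow> word (rev w) (word w x) = x"
  by (induction w) (auto simp: S_square word_closed)

lemma word_isometry:
  "x \<in> hcarrier H \<Longrightarrow> y \<in> hcarrier H \<Longrightarrow> hinner H (word w x) (word w y) = hinner H x y"
  by (simp add: word_adjoint word_closed word_rev)

lemma word_inj_on: "inj_on (word w) (hcarrier H)"
  by (metis inj_on_inverseI word_rev)

lemma orthonormal_basis_word:
  assumes "orthonormal_basis H B"
  shows "orthonormal_basis H (word w ` B)"
proof -
  have B: "e \<in> hcarrier H" if "e \<in> B" for e
    using that assms by (auto simp: orthonormal_basis_def)
  have "x = hzero H" if x: "x \<in> hcarrier H" and o: "\<And>e. e \<in> B \<Longrightarrow> hinner H (word w e) x = 0" for x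
  proof -
    have "word (rev w) x = hzero H"
      using assms x o by (auto simp: orthonormal_basis_def word_adjoint B word_closed)
    then have "hinner H x x = 0"
      using word_isometry[OF x x, of "rev w"] by (simp add: inner_zero_left zero_closed)
    with x show ?thesis by (rule inner_definite)
  qed
  moreover have "hinner H (word w e) (word w f) = (if word w e = word w f then 1 else 0)"
    if "e \<in> B" "f \<in> B" for e f
    using that assms inj_on_eq_iff[OF word_inj_on B B]
    by (simp add: word_isometry B) (simp add: orthonormal_basis_def)
  ultimately show ?thesis
    unfolding orthonormal_basis_def using word_closed B by auto
qed

text \<open>Conjugation invariance of the trace, obtained by evaluating \<open>has_trace\<close> in
  the basis rotated by the word.\<close>

lemma has_trace_word:
  assumes "has_trace H A t" "orthonormal_basis H B"
  shows "((\<lambda>e. hinner H (word w e) (A (word w e))) has_sum t) B"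
proof -
  have "inj_on (word w) B"
    using assms(2) word_inj_on inj_on_subset by (auto simp: orthonormal_basis_def)
  moreover have "((\<lambda>e. hinner H e (A e)) has_sum t) (word w ` B)"
    using assms orthonormal_basis_word by (auto simp: has_trace_def)
  ultimately show ?thesis by (simp add: has_sum_reindex o_def)
qed

end

locale hilbert_state = complex_hilbert_space H for H :: "'v hspace" +
  fixes \<rho> :: "'v \<Rightarrow> 'v"
  assumes positive: "positive_operator H \<rho>"
begin

definition form :: "'v \<Rightarrow> 'v \<Rightarrow> complex" where
  "form x y = hinner H x (\<rho> y)"

lemma rho_closed: "x \<in> hcarrier H \<Longrightarrow> \<rho> x \<in> hcarrier H"
  and rho_add: "x \<in> hcarrier H \<Longrightarrow> y \<in> hcarrier H \<Longrightarrow> \<rho> (hadd H x y) = hadd H (\<rho> x) (\<rho> y)"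
  and rho_scale: "x \<in> hcarrier H \<Longrightarrow> \<rho> (hscale H c x) = hscale H c (\<rho> x)"
  and rho_adjoint: "x \<in> hcarrier H \<Longrightarrow> y \<in> hcarrier H \<Longrightarrow> hinner H (\<rho> x) y = hinner H x (\<rho> y)"
  and form_nonneg: "x \<in> hcarrier H \<Longrightarrow> 0 \<le> Re (form x x)"
  using positive
  unfolding form_def positive_operator_def self_adjoint_operator_def bounded_operator_def by auto

lemma form_herm: "x \<in> hcarrier H \<Longrightarrow> y \<in> hcarrier H \<Longrightarrow> form y x = cnj (form x y)"
  by (metis form_def inner_commute rho_adjoint rho_closed)

lemma form_add_right:
  "\<lbrakk>x \<in> hcarrier H; y \<in> hcarrier H; z \<in> hcarrier H\<rbrakk> \<Longrightarrow> form x (hadd H y z) = form x y + form x z"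
  by (simp add: form_def rho_add inner_add_right rho_closed)

lemma form_add_left:
  "\<lbrakk>x \<in> hcarrier H; y \<in> hcarrier H; z \<in> hcarrier H\<rbrakk> \<Longrightarrow> form (hadd H x y) z = form x z + form y z"
  by (simp add: form_def inner_add_left rho_closed)

lemma form_scale_right: "\<lbrakk>x \<in> hcarrier H; y \<in> hcarrier H\<rbrakk> \<Longrightarrow> form x (hscale H c y) = c * form x y"
  by (simp add: form_def rho_scale inner_scale_right rho_closed)

lemma form_scale_left: "\<lbrakk>x \<in> hcarrier H; y \<in> hcarrier H\<rbrakk> \<Longrightarrow> form (hscale H c x) y = cnj c * form x y"
  by (simp add: form_def inner_scale_left rho_closed)

text \<open>A weak Cauchy-Schwarz inequality, from positivity at x + c y for c = 1, -1,
  \<open>\<i>\<close>, \<open>- \<i>\<close>. Its right-hand side is diagonal and therefore summable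
  over a basis, which makes the series defining \<open>F\<close> converge absolutely.\<close>

lemma form_bound:
  assumes x: "x \<in> hcarrier H" and y: "y \<in> hcarrier H"
  shows "cmod (form x y) \<le> Re (form x x) + Re (form y y)"
proof -
  have "0 \<le> Re (form x x) + Re (cnj c * c * form y y) + 2 * Re (c * form x y)" for c
  proof -
    have "0 \<le> Re (form (hadd H x (hscale H c y)) (hadd H x (hscale H c y)))"
      by (intro form_nonneg add_closed scale_closed x y)
    also have "form (hadd H x (hscale H c y)) (hadd H x (hscale H c y))
        = form x x + cnj c * c * form y y + (c * form x y + cnj (c * form x y))"
      using x y form_herm[OF x y]
      by (simp add: form_add_left form_add_right form_scale_left form_scale_right add_closed scale_closed algebra_simps)
    finally show ?thesis by simp
  qed
  from this[of 1] this[of "- 1"] this[of \<i>] this[of "- \<i>"]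
  have "\<bar>Re (form x y)\<bar> + \<bar>Im (form x y)\<bar> \<le> Re (form x x) + Re (form y y)" by auto
  then show ?thesis using cmod_le[of "form x y"] by linarith
qed

lemma form_pos:
  assumes x: "\<And>p. x p \<in> hcarrier H"
  shows "0 \<le> Re (\<Sum>p<(n::nat). \<Sum>q<n. cnj (c p) * c q * form (x p) (x q))"
proof -
  \<comment> \<open>The witness is the linear combination of the \<open>x p\<close> with
    coefficients \<open>c p\<close>, built by binary additions and characterised by its pairings
    with all vectors.\<close>
  have "\<exists>z\<in>hcarrier H. \<forall>y\<in>hcarrier H.
      form z y = (\<Sum>p<n. cnj (c p) * form (x p) y) \<and> form y z = (\<Sum>q<n. c q * form y (x q))"
  proof (induction n)
    case 0
    have "form (hzero H) y = 0 \<and> form y (hzero H) = 0" if "y \<in> hcarrier H" for y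
      using that form_herm[OF zero_closed that] by (simp add: form_def inner_zero_left rho_closed)
    then show ?case
      using zero_closed by (intro bexI[of _ "hzero H"]) auto
  next
    case (Suc n)
    then obtain z where z: "z \<in> hcarrier H" "\<And>y. y \<in> hcarrier H \<Longrightarrow>
      form z y = (\<Sum>p<n. cnj (c p) * form (x p) y) \<and> form y z = (\<Sum>q<n. c q * form y (x q))" by blast
    show ?case
      by (intro bexI[of _ "hadd H z (hscale H (c n) (x n))"] ballI add_closed scale_closed x z(1))
        (simp add: form_add_left form_add_right form_scale_left form_scale_right scale_closed x z)
  qed
  then obtain z where z: "z \<in> hcarrier H" "\<And>y. y \<in> hcarrier H \<Longrightarrow>
      form z y = (\<Sum>p<n. cnj (c p) * form (x p) y) \<and> form y z = (\<Sum>q<n. c q * form y (x q))" by blast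
  have "form z z = (\<Sum>p<n. cnj (c p) * form (x p) z)"
    using z by blast
  also have "\<dots> = (\<Sum>p<n. cnj (c p) * (\<Sum>q<n. c q * form (x p) (x q)))"
    using z(2)[OF x] by simp
  finally have "form z z = (\<Sum>p<n. \<Sum>q<n. cnj (c p) * c q * form (x p) (x q))"
    by (simp add: sum_distrib_left mult.assoc)
  then show ?thesis using form_nonneg[OF z(1)] by simp
qed

end

lemma has_sum_sum:
  assumes "\<And>a. a \<in> A \<Longrightarrow> (f a has_sum s a) B"
  shows "((\<lambda>x. \<Sum>a\<in>A. f a x) has_sum (\<Sum>a\<in>A. s a :: 'z::topological_comm_monoid_add)) B"
  using assms by (induction A rule: infinite_finite_induct) (auto intro: has_sum_add)

lemma density_word_gram:
  fixes H :: "'v hspace" and E :: "'n \<Rightarrow> 'n \<Rightarrow> bool"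
  assumes "complex_hilbert_space H" and saur: "SAUR H E S" and dens: "density_operator H \<rho>"
    and trace: "\<And>i. has_trace H (\<rho> \<circ> S i) (complex_of_real (t i))"
  obtains F where "word_gram E t F"
proof -
  interpret complex_hilbert_space H by fact
  interpret hilbert_saur H E S by unfold_locales fact
  interpret hilbert_state H \<rho>
    using dens by unfold_locales (simp add: density_operator_def)
  obtain B where B: "orthonormal_basis H B" using orthonormal_basis_exists ..
  have Bc: "e \<in> hcarrier H" if "e \<in> B" for e
    using that B by (auto simp: orthonormal_basis_def)
  define F where "F u w = (\<Sum>\<^sub>\<infinity>e\<in>B. form (word u e) (word w e))" for u w
  have diag: "((\<lambda>e. form (word u e) (word u e)) has_sum 1) B" for u
    using has_trace_word[OF _ B, of \<rho> 1 u] dens by (simp add: density_operator_def form_def)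
  have F: "((\<lambda>e. form (word u e) (word w e)) has_sum F u w) B" for u w
  proof -
    have "(\<lambda>e. Re (form (word u e) (word u e)) + Re (form (word w e) (word w e))) summable_on B"
      by (intro summable_on_add has_sum_imp_summable[OF has_sum_Re[OF diag]])
    then have "(\<lambda>e. norm (form (word u e) (word w e))) summable_on B"
      by (rule summable_on_comparison_test) (auto intro!: form_bound word_closed simp: Bc)
    then show ?thesis
      unfolding F_def by (rule has_sum_infsum[OF abs_summable_summable])
  qed
  have F_eq: "F u w = c * F u w'" if "\<And>e. e \<in> B \<Longrightarrow> word w e = hscale H c (word w' e)" for u w w' c
  proof -
    have "F u w = (\<Sum>\<^sub>\<infinity>e\<in>B. c * form (word u e) (word w' e))"
      unfolding F_def using that by (intro infsum_cong) (simp add: form_scale_right word_closed Bc)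
    then show ?thesis by (simp add: F_def infsum_cmult_right')
  qed
  have "word_gram E t F"
  proof
    show "F w u = cnj (F u w)" for u w
    proof -
      have "F w u = (\<Sum>\<^sub>\<infinity>e\<in>B. cnj (form (word u e) (word w e)))"
        unfolding F_def by (intro infsum_cong form_herm word_closed Bc)
      then show ?thesis by (simp add: F_def)
    qed
    show "F w w = 1" for w
      using infsumI[OF diag] by (simp add: F_def)
    show "F w (j # w) = complex_of_real (t j)" for w j
      using has_trace_word[OF trace[of j] B, of w] by (simp add: F_def form_def infsumI)
    show "F u (a @ [i, i] @ b) = F u (a @ b)" for u a i b
      using F_eq[of "a @ [i, i] @ b" 1 "a @ b" u] by (simp add: S_square word_closed Bc scale_one)
    show "F u (a @ [i, j] @ b) = (if E i j then - 1 else 1) * F u (a @ [j, i] @ b)" for u a i j b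
    proof (rule F_eq)
      fix e assume "e \<in> B"
      then have "word b e \<in> hcarrier H" by (intro word_closed Bc)
      then show "word (a @ [i, j] @ b) e = hscale H (if E i j then - 1 else 1) (word (a @ [j, i] @ b) e)"
        by (simp add: S_swap[of _ i j] word_scale S_closed)
    qed
    show "0 \<le> Re (\<Sum>p<(n::nat). \<Sum>q<n. cnj (c p) * c q * F (y p) (y q))" for n c y
    proof -
      have "((\<lambda>e. \<Sum>p<n. \<Sum>q<n. cnj (c p) * c q * form (word (y p) e) (word (y q) e))
          has_sum (\<Sum>p<n. \<Sum>q<n. cnj (c p) * c q * F (y p) (y q))) B"
        by (intro has_sum_sum has_sum_cmult_right F)
      from has_sum_Re[OF this] show ?thesis
        by (rule has_sum_nonneg) (intro form_pos word_closed Bc)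
    qed
  qed
  then show thesis by (rule that)
qed

section \<open>Attaining independent sets\<close>

definition ip :: "('a::finite \<Rightarrow> complex) \<Rightarrow> ('a \<Rightarrow> complex) \<Rightarrow> complex" where
  "ip f g = (\<Sum>x\<in>UNIV. cnj (f x) * g x)"

lemma ip_cnj: "ip g f = cnj (ip f g)"
  by (simp add: ip_def mult.commute)

lemma ip_diff_right: "ip f (\<lambda>x. g x - h x) = ip f g - ip f h"
  by (simp add: ip_def algebra_simps sum_subtractf)

lemma ip_add_right: "ip f (\<lambda>x. g x + h x) = ip f g + ip f h"
  by (simp add: ip_def algebra_simps sum.distrib)

lemma ip_scale_right: "ip f (\<lambda>x. c * g x) = c * ip f g"
  by (simp add: ip_def sum_distrib_left mult_ac)

lemma ip_sum_right: "ip f (\<lambda>x. \<Sum>e\<in>F. c e * h e x) = (\<Sum>e\<in>F. c e * ip f (h e))"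
  unfolding ip_def sum_distrib_left by (subst sum.swap) (simp add: mult_ac)

lemma ip_self: "ip f f = complex_of_real (\<Sum>x\<in>UNIV. (cmod (f x))\<^sup>2)"
  unfolding ip_def of_real_sum by (intro sum.cong refl) (metis complex_norm_square mult.commute)

lemma ip_self_nonneg: "0 \<le> Re (ip f f)"
  unfolding ip_self by (simp add: sum_nonneg)

lemma ip_self_eq_0: "ip f f = 0 \<longleftrightarrow> f = (\<lambda>_. 0)"
  unfolding ip_self of_real_eq_0_iff by (subst sum_nonneg_eq_0_iff) auto

abbreviation delta :: "'a \<Rightarrow> 'a \<Rightarrow> complex" where
  "delta y \<equiv> (\<lambda>x. if x = y then 1 else 0)"

lemma ip_delta_left: "ip (delta y) f = f y" and ip_delta_right: "ip f (delta y) = cnj (f y)"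
proof -
  have "ip (delta y) f = (\<Sum>x\<in>UNIV. if x = y then f x else 0)"
    unfolding ip_def by (intro sum.cong) auto
  then show "ip (delta y) f = f y" by simp
  then show "ip f (delta y) = cnj (f y)" by (subst ip_cnj) simp
qed

text \<open>\<open>h\<close> is the component of \<open>g\<close> orthogonal to \<open>F\<close>;
  nonnegativity of its squared norm is Bessel's inequality.\<close>

lemma orthonormal_remainder:
  fixes F :: "('a::finite \<Rightarrow> complex) set" and g :: "'a \<Rightarrow> complex"
  assumes F: "finite F" and on: "\<And>e f. e \<in> F \<Longrightarrow> f \<in> F \<Longrightarrow> ip e f = (if e = f then 1 else 0)"
  defines "h \<equiv> (\<lambda>x. g x - (\<Sum>e\<in>F. ip e g * e x))"
  shows "\<And>e. e \<in> F \<Longrightarrow> ip e h = 0"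
    and "(\<Sum>e\<in>F. (cmod (ip e g))\<^sup>2) \<le> Re (ip g g)"
proof -
  show *: "ip e h = 0" if "e \<in> F" for e
  proof -
    have "(\<Sum>f\<in>F. ip f g * ip e f) = (\<Sum>f\<in>F. if e = f then ip f g else 0)"
      using on that by (intro sum.cong) auto
    also have "\<dots> = ip e g" using F that by simp
    finally show ?thesis unfolding h_def ip_diff_right ip_sum_right by simp
  qed
  have "ip h e = 0" if "e \<in> F" for e
    using *[OF that] by (subst ip_cnj) simp
  then have "ip h h = ip h g"
    unfolding h_def[abs_def] ip_diff_right ip_sum_right by simp
  also have "\<dots> = cnj (ip g h)" by (rule ip_cnj)
  also have "ip g h = ip g g - (\<Sum>e\<in>F. ip e g * ip g e)"
    unfolding h_def ip_diff_right ip_sum_right by simp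
  also have "(\<Sum>e\<in>F. ip e g * ip g e) = complex_of_real (\<Sum>e\<in>F. (cmod (ip e g))\<^sup>2)"
    unfolding of_real_sum by (intro sum.cong refl) (subst (2) ip_cnj, simp only: complex_norm_square)
  finally have "Re (ip h h) = Re (ip g g) - (\<Sum>e\<in>F. (cmod (ip e g))\<^sup>2)" by simp
  with ip_self_nonneg[of h] show "(\<Sum>e\<in>F. (cmod (ip e g))\<^sup>2) \<le> Re (ip g g)" by simp
qed

text \<open>The double sum of |e x|^2 over basis vectors and coordinates equals
  \<open>card F\<close>, and Bessel's inequality for each unit vector bounds it by the
  dimension.\<close>

lemma orthonormal_finite:
  fixes B :: "('a::finite \<Rightarrow> complex) set"
  assumes on: "\<And>e f. e \<in> B \<Longrightarrow> f \<in> B \<Longrightarrow> ip e f = (if e = f then 1 else 0)"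
  shows "finite B"
proof (rule conjunct1[OF finite_if_finite_subsets_card_bdd[of _ "CARD('a)"]])
  fix F assume F: "F \<subseteq> B" "finite F"
  have "real (card F) = (\<Sum>e\<in>F. Re (ip e e))"
    using on F by (simp add: subset_iff)
  also have "\<dots> = (\<Sum>x\<in>UNIV. \<Sum>e\<in>F. (cmod (ip e (delta x)))\<^sup>2)"
    unfolding ip_self ip_delta_right by (subst sum.swap) simp
  also have "\<dots> \<le> (\<Sum>x\<in>(UNIV::'a set). Re (ip (delta x) (delta x)))"
    using F by (intro sum_mono orthonormal_remainder(2) on) auto
  also have "\<dots> = real CARD('a)" by (simp add: ip_delta_left)
  finally show "card F \<le> CARD('a)" by simp
qed

lemma orthonormal_parseval:
  fixes B :: "('a::finite \<Rightarrow> complex) set"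
  assumes on: "\<And>e f. e \<in> B \<Longrightarrow> f \<in> B \<Longrightarrow> ip e f = (if e = f then 1 else 0)"
    and complete: "\<And>g. (\<And>e. e \<in> B \<Longrightarrow> ip e g = 0) \<Longrightarrow> g = (\<lambda>_. 0)"
  shows "(\<Sum>e\<in>B. ip k e * ip e g) = ip k g"
proof -
  have "finite B" using on by (rule orthonormal_finite)
  then have "(\<lambda>x. g x - (\<Sum>e\<in>B. ip e g * e x)) = (\<lambda>_. 0)"
    using on by (intro complete orthonormal_remainder(1)) auto
  then have "ip k g - (\<Sum>e\<in>B. ip e g * ip k e) = ip k (\<lambda>_. 0)"
    by (simp flip: ip_sum_right ip_diff_right)
  then show ?thesis by (simp add: ip_def mult.commute)
qed

text \<open>The structure of the coordinate space is transported along an injection because the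
  Hilbert space has to live in the prescribed type \<open>'v\<close>.\<close>

definition fun_hspace :: "(('a::finite \<Rightarrow> complex) \<Rightarrow> 'v) \<Rightarrow> 'v hspace" where
  "fun_hspace \<phi> = \<lparr> hcarrier = range \<phi>, hzero = \<phi> (\<lambda>_. 0),
     hadd = (\<lambda>u w. \<phi> (\<lambda>x. inv \<phi> u x + inv \<phi> w x)),
     hscale = (\<lambda>c u. \<phi> (\<lambda>x. c * inv \<phi> u x)),
     hinner = (\<lambda>u w. ip (inv \<phi> u) (inv \<phi> w)) \<rparr>"

locale fun_hilbert =
  fixes \<phi> :: "('a::finite \<Rightarrow> complex) \<Rightarrow> 'v"
  assumes inj: "inj \<phi>"
begin

abbreviation "H \<equiv> fun_hspace \<phi>"

lemma H_simps:
  "hcarrier H = range \<phi>"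
  "hzero H = \<phi> (\<lambda>_. 0)"
  "hadd H (\<phi> f) (\<phi> g) = \<phi> (\<lambda>x. f x + g x)"
  "hscale H c (\<phi> f) = \<phi> (\<lambda>x. c * f x)"
  "hinner H (\<phi> f) (\<phi> g) = ip f g"
  "inv \<phi> (\<phi> f) = f"
  by (simp_all add: fun_hspace_def inj)

lemma hnorm_eq: "hnorm H (\<phi> f) = L2_set (\<lambda>x. cmod (f x)) UNIV"
  by (simp add: hnorm_def H_simps ip_self L2_set_def)

lemma hdist_eq: "hdist H (\<phi> f) (\<phi> g) = L2_set (\<lambda>x. cmod (f x - g x)) UNIV"
  by (simp add: hdist_def H_simps hnorm_eq)

lemma hilbert: "complex_hilbert_space H"
proof
  fix X :: "nat \<Rightarrow> 'v"
  assume X: "\<And>n. X n \<in> hcarrier H" and cauchy: "\<forall>e>0. \<exists>N. \<forall>m\<ge>N. \<forall>n\<ge>N. hdist H (X m) (X n) < e"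
  have "\<exists>f. X n = \<phi> f" for n using X[of n] by (auto simp: H_simps)
  then obtain f where f: "X = (\<lambda>n. \<phi> (f n))" by metis
  have "Cauchy (\<lambda>n. f n x)" for x
    unfolding Cauchy_def
  proof (intro allI impI)
    fix e :: real assume "0 < e"
    with cauchy obtain N where N: "\<And>m n. m \<ge> N \<Longrightarrow> n \<ge> N \<Longrightarrow> hdist H (X m) (X n) < e" by blast
    have "dist (f m x) (f n x) < e" if "m \<ge> N" "n \<ge> N" for m n
    proof -
      have "cmod (f m x - f n x) \<le> hdist H (X m) (X n)"
        unfolding f hdist_eq by (intro member_le_L2_set) auto
      with N[OF that] show ?thesis by (simp add: dist_norm)
    qed
    then show "\<exists>N. \<forall>m\<ge>N. \<forall>n\<ge>N. dist (f m x) (f n x) < e" by blast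
  qed
  then have "\<forall>x. \<exists>l. (\<lambda>n. f n x) \<longlonglongrightarrow> l"
    by (simp add: Cauchy_convergent_iff convergent_def)
  then obtain g where g: "\<And>x. (\<lambda>n. f n x) \<longlonglongrightarrow> g x" by metis
  have "(\<lambda>n. sqrt (\<Sum>x\<in>UNIV. (cmod (f n x - g x))\<^sup>2)) \<longlonglongrightarrow> sqrt (\<Sum>x\<in>(UNIV::'a set). (cmod (g x - g x))\<^sup>2)"
    by (intro tendsto_intros g)
  then have "(\<lambda>n. hdist H (X n) (\<phi> g)) \<longlonglongrightarrow> 0"
    by (simp add: f hdist_eq L2_set_def)
  then show "\<exists>x\<in>hcarrier H. (\<lambda>n. hdist H (X n) x) \<longlonglongrightarrow> 0"
    by (auto simp: H_simps)
next
  fix x y assume "x \<in> hcarrier H" "y \<in> hcarrier H"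
  then show "hinner H y x = cnj (hinner H x y)"
    by (auto simp: H_simps intro: ip_cnj)
qed (auto simp: H_simps ip_add_right ip_scale_right ip_self_eq_0 ip_self_nonneg algebra_simps)

text \<open>The assumption gives \<open>A\<close> the diagonal entries of the rank-one operator
  sending f to \<open>ip k f\<close> times g; by Parseval they have the same sum in every
  basis.\<close>

lemma has_trace_rank_one:
  assumes "\<And>f. hinner H (\<phi> f) (A (\<phi> f)) = ip k f * ip f g"
  shows "has_trace H A (ip k g)"
  unfolding has_trace_def
proof (intro allI impI)
  fix B assume B: "orthonormal_basis H B"
  define B' where "B' = {f. \<phi> f \<in> B}"
  have B_eq: "B = \<phi> ` B'"
    using B by (auto simp: B'_def orthonormal_basis_def H_simps)
  have on: "ip e f = (if e = f then 1 else 0)" if "e \<in> B'" "f \<in> B'" for e f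
  proof -
    have "hinner H (\<phi> e) (\<phi> f) = (if \<phi> e = \<phi> f then 1 else 0)"
      using B that unfolding B'_def orthonormal_basis_def by blast
    then show ?thesis using inj by (simp add: H_simps inj_eq)
  qed
  have complete: "h = (\<lambda>_. 0)" if "\<And>e. e \<in> B' \<Longrightarrow> ip e h = 0" for h
  proof -
    have "\<forall>e\<in>B. hinner H e (\<phi> h) = 0" using that by (auto simp: B_eq H_simps)
    then have "\<phi> h = hzero H" using B by (auto simp: orthonormal_basis_def H_simps)
    then show ?thesis using inj by (simp add: H_simps inj_eq)
  qed
  have "((\<lambda>f. ip k f * ip f g) has_sum ip k g) B'"
    using orthonormal_finite[OF on] orthonormal_parseval[OF on complete, where k = k and g = g]
    by (intro has_sum_finiteI) auto
  then show "((\<lambda>e. hinner H e (A e)) has_sum ip k g) B"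
    unfolding B_eq by (subst has_sum_reindex) (use inj in \<open>auto simp: o_def assms inj_on_def inj_def\<close>)
qed

end

text \<open>An infinite set absorbs its square, so the coordinates can be packed into one complex
  number one at a time.\<close>

lemma inj_fun_complex: "\<exists>g :: ('a::finite \<Rightarrow> complex) \<Rightarrow> complex. inj g"
proof -
  have "infinite (UNIV :: complex set)" by (rule infinite_UNIV_char_0)
  from card_of_Times_same_infinite[OF this]
  obtain h :: "complex \<times> complex \<Rightarrow> complex" where h: "inj h"
    unfolding card_of_ordIso[symmetric] by (auto simp: bij_betw_def)
  have "\<exists>g :: ('a \<Rightarrow> complex) \<Rightarrow> complex. \<forall>f f'. g f = g f' \<longrightarrow> (\<forall>x\<in>K. f x = f' x)" for K :: "'a set"
    using finite[of K]
  proof induction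
    case (insert a K)
    then obtain g :: "('a \<Rightarrow> complex) \<Rightarrow> complex" where "\<forall>f f'. g f = g f' \<longrightarrow> (\<forall>x\<in>K. f x = f' x)" by blast
    then show ?case
      by (intro exI[of _ "\<lambda>f. h (f a, g f)"]) (simp add: inj_eq[OF h])
  qed simp
  from this[of UNIV] show ?thesis by (auto simp: inj_def fun_eq_iff)
qed

text \<open>A representation on \<open>\<complex>\<^bsup>Pow V\<^esup>\<close> for which the state \<open>delta {}\<close> has expectation 1 at
  the vertices of the independent set \<open>A\<close>, which act diagonally, and 0 at all others, which act as
  signed bit flips.\<close>

locale independent_saur =
  fixes E :: "'n::finite \<Rightarrow> 'n \<Rightarrow> bool" and A :: "'n set" and r :: "'n \<Rightarrow> nat"
  assumes sym: "E i j \<Longrightarrow> E j i" and irrefl: "\<not> E i i"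
    and indep: "i \<in> A \<Longrightarrow> j \<in> A \<Longrightarrow> \<not> E i j" and r: "inj r"
begin

definition flip :: "'n \<Rightarrow> 'n set \<Rightarrow> 'n set" where
  "flip i X = (if i \<in> A then X else if i \<in> X then X - {i} else insert i X)"

text \<open>The sign that the operator of \<open>i\<close> takes from bit \<open>j\<close>. A
  diagonal operator reads all its neighbours. Between two flipping vertices the order
  \<open>r\<close> selects one endpoint of the edge, so that exactly one of the two notices the flip
  of the other, as in the Jordan-Wigner construction.\<close>

definition dsign :: "'n \<Rightarrow> 'n \<Rightarrow> complex" where
  "dsign i j = (if E i j \<and> (i \<in> A \<or> r j < r i) then - 1 else 1)"

definition sgn_flip :: "'n \<Rightarrow> 'n set \<Rightarrow> complex" where
  "sgn_flip i X = (\<Prod>j\<in>X. dsign i j)"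

definition T :: "'n \<Rightarrow> ('n set \<Rightarrow> complex) \<Rightarrow> 'n set \<Rightarrow> complex" where
  "T i f X = sgn_flip i X * f (flip i X)"

lemma flip_flip: "flip i (flip i X) = X"
  by (auto simp: flip_def)

lemma flip_commute: "flip i (flip j X) = flip j (flip i X)"
  by (auto simp: flip_def)

lemma dsign_square: "dsign i j * dsign i j = 1"
  by (simp add: dsign_def)

lemma sgn_flip_flip: "sgn_flip i (flip j X) = sgn_flip i X * (if j \<in> A then 1 else dsign i j)"
proof (cases "j \<in> A \<or> j \<notin> X")
  case True
  then show ?thesis by (auto simp: flip_def sgn_flip_def)
next
  case False
  then have "sgn_flip i X = dsign i j * sgn_flip i (X - {j})"
    unfolding sgn_flip_def by (intro prod.remove) auto
  with False show ?thesis by (simp add: flip_def dsign_square mult_ac)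
qed

lemma sgn_flip_self: "sgn_flip i (flip i X) = sgn_flip i X"
  unfolding sgn_flip_flip by (simp add: dsign_def irrefl)

lemma sgn_flip_square: "sgn_flip i X * sgn_flip i X = 1"
  by (simp add: sgn_flip_def dsign_square flip: prod.distrib)

lemma cnj_sgn_flip: "cnj (sgn_flip i X) = sgn_flip i X"
  unfolding sgn_flip_def dsign_def cnj_prod by (intro prod.cong) auto

lemma T_T: "T i (T i f) = f"
  by (simp add: T_def fun_eq_iff flip_flip sgn_flip_self mult.assoc[symmetric] sgn_flip_square)

lemma T_commute: "T i (T j f) X = (if E i j then - 1 else 1) * T j (T i f) X"
proof -
  \<comment> \<open>The two orders differ by the signs that each operator receives from the flip of
    the other one, and vertices in \<open>A\<close> flip nothing.\<close>
  have "(if i \<in> A then 1 else dsign j i) = (if E i j then - 1 else 1) * (if j \<in> A then 1 else dsign i j)"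
  proof (cases "E i j")
    case True
    then have "r i \<noteq> r j" using irrefl r by (metis injD)
    then show ?thesis using True sym[OF True] indep[of i j] by (auto simp: dsign_def)
  next
    case False
    then show ?thesis using sym[of j i] by (auto simp: dsign_def)
  qed
  then show ?thesis
    by (simp add: T_def sgn_flip_flip flip_commute[of j i] mult_ac)
qed

lemma ip_T: "ip (T i f) g = ip f (T i g)"
proof -
  have "bij (flip i)" by (rule o_bij[of "flip i"]) (auto simp: flip_flip)
  then have "ip f (T i g) = (\<Sum>X\<in>UNIV. cnj (f (flip i X)) * T i g (flip i X))"
    unfolding ip_def by (rule sum.reindex_bij_betw[symmetric])
  also have "\<dots> = ip (T i f) g"
    by (simp add: ip_def T_def flip_flip sgn_flip_self cnj_sgn_flip mult_ac)
  finally show ?thesis ..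
qed

lemma indicator_in_squared_expectations:
  assumes "inj (\<phi> :: ('n set \<Rightarrow> complex) \<Rightarrow> 'v)"
  shows "(\<chi> i. if i \<in> A then 1 else 0) \<in> squared_expectations TYPE('v) E"
proof -
  interpret fun_hilbert \<phi> by unfold_locales fact
  define S where "S i x = \<phi> (T i (inv \<phi> x))" for i x
  define \<rho> where "\<rho> x = \<phi> (\<lambda>X. if X = {} then inv \<phi> x {} else 0)" for x
  define t where "t i = (if i \<in> A then 1 else 0 :: real)" for i
  have S: "S i (\<phi> f) = \<phi> (T i f)" for i f
    by (simp add: S_def H_simps)
  have rho: "\<rho> (\<phi> f) = \<phi> (\<lambda>X. f {} * delta {} X)" for f
    unfolding \<rho>_def H_simps by (rule arg_cong[of _ _ \<phi>]) auto
  have "self_adjoint_operator H (S i)" for i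
  proof -
    have "hnorm H (\<phi> (T i f)) = hnorm H (\<phi> f)" for f
      by (simp add: hnorm_def H_simps ip_T T_T)
    then have "\<exists>K. \<forall>f. hnorm H (\<phi> (T i f)) \<le> K * hnorm H (\<phi> f)"
      by (intro exI[of _ 1]) simp
    moreover have "T i (\<lambda>x. f x + g x) = (\<lambda>x. T i f x + T i g x)" "T i (\<lambda>x. c * f x) = (\<lambda>x. c * T i f x)" for f g c
      by (auto simp: T_def algebra_simps)
    ultimately show ?thesis
      by (simp add: self_adjoint_operator_def bounded_operator_def H_simps S ip_T)
  qed
  moreover have "T i (T j f) = (\<lambda>x. - 1 * T j (T i f) x)" if "E i j" for i j f
    using T_commute[of i j f] that by (intro ext) simp
  moreover have "T i (T j f) = T j (T i f)" if "\<not> E i j" for i j f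
    using T_commute[of i j f] that by (intro ext) simp
  ultimately have saur: "SAUR H E S"
    unfolding SAUR_def H_simps by (simp add: S T_T H_simps) metis
  have "positive_operator H \<rho>"
  proof -
    have ip_rho: "ip f (\<lambda>X. g {} * delta {} X) = g {} * cnj (f {})" for f g :: "'n set \<Rightarrow> complex"
      unfolding ip_scale_right ip_delta_right ..
    have ip_rho': "ip (\<lambda>X. g {} * delta {} X) f = cnj (g {}) * f {}" for f g :: "'n set \<Rightarrow> complex"
      by (subst ip_cnj) (simp only: ip_rho complex_cnj_mult complex_cnj_cnj mult.commute)
    have "hnorm H (\<rho> (\<phi> f)) \<le> 1 * hnorm H (\<phi> f)" for f
    proof -
      have "hnorm H (\<rho> (\<phi> f)) = cmod (f {})"
        unfolding hnorm_def rho H_simps ip_rho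
        by (simp add: complex_norm_square[symmetric] mult.commute flip: of_real_power)
      also have "\<dots> \<le> hnorm H (\<phi> f)"
        unfolding hnorm_eq by (intro member_le_L2_set) auto
      finally show ?thesis by simp
    qed
    then have "\<exists>K. \<forall>f. hnorm H (\<rho> (\<phi> f)) \<le> K * hnorm H (\<phi> f)" by blast
    moreover have "0 \<le> Re (ip f (\<lambda>X. f {} * delta {} X))" for f :: "'n set \<Rightarrow> complex"
      unfolding ip_rho by simp
    moreover have "ip (\<lambda>X. f {} * delta {} X) g = ip f (\<lambda>X. g {} * delta {} X)" for f g :: "'n set \<Rightarrow> complex"
      unfolding ip_rho ip_rho' by simp
    ultimately show ?thesis
      unfolding positive_operator_def self_adjoint_operator_def bounded_operator_def H_simps
      by (simp add: rho H_simps distrib_right mult.assoc )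
  qed
  moreover have "has_trace H \<rho> (ip (delta ({} :: 'n set)) (delta {}))"
    by (rule has_trace_rank_one[where k = "delta {}" and g = "delta {}"])
      (simp only: rho H_simps ip_scale_right ip_delta_left)
  ultimately have dens: "density_operator H \<rho>"
    by (simp add: density_operator_def ip_delta_left)
  have "has_trace H (\<rho> \<circ> S i) (complex_of_real (t i))" for i
  proof -
    \<comment> \<open>The sign at \<open>{}\<close> is an empty product, so the trace is 1 or 0
      according to whether \<open>flip i\<close> fixes \<open>{}\<close>, that is, whether
      \<open>i\<close> lies in \<open>A\<close>.\<close>
    have "has_trace H (\<rho> \<circ> S i) (ip (delta (flip i {})) (delta {}))"
      by (rule has_trace_rank_one[where k = "delta (flip i {})" and g = "delta {}"])
        (simp only: o_apply S rho H_simps ip_scale_right ip_delta_left, simp add: T_def sgn_flip_def)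
    moreover have "ip (delta (flip i {})) (delta {}) = complex_of_real (t i)"
      by (simp add: ip_delta_left flip_def t_def)
    ultimately show ?thesis by simp
  qed
  moreover have "(\<chi> i. if i \<in> A then 1 else 0) = ((\<chi> i. (t i)\<^sup>2) :: real ^ 'n)"
    by (simp add: vec_eq_iff t_def)
  ultimately show ?thesis
    unfolding squared_expectations_def using hilbert saur dens by blast
qed

end

section \<open>Odd and even cycles\<close>

lemma squared_expectations_cycle_bounds:
  fixes E :: "'n::finite \<Rightarrow> 'n \<Rightarrow> bool"
  assumes m: "3 \<le> m" and v: "bij_betw v {..<m} UNIV"
    and E: "\<forall>i<m. \<forall>j<m. E (v i) (v j) \<longleftrightarrow> j = (i + 1) mod m \<or> i = (j + 1) mod m"
    and sym: "\<And>i j. E i j \<Longrightarrow> E j i"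
    and q: "q \<in> squared_expectations TYPE('v) E"
  shows "0 \<le> q $ i" and "E i j \<Longrightarrow> q $ i + q $ j \<le> 1" and "(\<Sum>i\<in>UNIV. q $ i) \<le> real (m div 2)"
proof -
  obtain t and H :: "'v hspace" and S \<rho> where t: "q = (\<chi> i. (t i)\<^sup>2)"
    and H: "complex_hilbert_space H" "SAUR H E S" "density_operator H \<rho>"
      "\<And>i. has_trace H (\<rho> \<circ> S i) (complex_of_real (t i))"
    using q unfolding squared_expectations_def by blast
  obtain F0 where "word_gram E t F0"
    by (rule density_word_gram[OF H])
  then obtain F where F: "word_gram E t F" "\<And>u w i. F (u @ [i]) (w @ [i]) = F u w"
    using word_gram_right_invariant by blast
  interpret invariant_word_gram E t F
    using F by (simp add: invariant_word_gram_def invariant_word_gram_axioms_def)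
  show "0 \<le> q $ i" by (simp add: t)
  show edge: "q $ i + q $ j \<le> 1" if "E i j" for i j
    using edge_bound[OF that sym[OF that]] by (simp add: t)
  show "(\<Sum>i\<in>UNIV. q $ i) \<le> real (m div 2)"
  proof (cases "even m")
    case True
    \<comment> \<open>Summing the \<open>m\<close> edge inequalities counts every vertex twice,
      which suffices for even \<open>m\<close>.\<close>
    have "2 * (\<Sum>i\<in>UNIV. q $ i) = (\<Sum>j<m. q $ v j) + (\<Sum>j<m. q $ v ((j+1) mod m))"
      using sum.reindex_bij_betw[OF v, of "\<lambda>i. q $ i"]
        sum.reindex_bij_betw[OF bij_betw_succ_mod, of "\<lambda>j. q $ v j" m] by simp
    also have "\<dots> = (\<Sum>j<m. q $ v j + q $ v ((j+1) mod m))"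
      by (simp add: sum.distrib)
    also have "\<dots> \<le> (\<Sum>j<m. 1)"
      using m E by (intro sum_mono edge) auto
    finally show ?thesis using True by (auto elim!: evenE)
  next
    case False
    interpret cycle_word_gram E t F v m
      using m False v E by unfold_locales auto
    show ?thesis using cycle_bound by (simp add: t)
  qed
qed

theorem theorem21:
  fixes E :: "'n::finite \<Rightarrow> 'n \<Rightarrow> bool" and m :: nat
  assumes "3 \<le> m"
    and "is_cycle_graph m E"
    and universe: "\<exists>f :: complex \<Rightarrow> 'v. inj f"
  shows "beta TYPE('v) E = real (independence_number E)
       \<and> Qbar TYPE('v) E = STAB E"
proof
  let ?Q = "squared_expectations TYPE('v) E"
  obtain v where v: "bij_betw v {..<m} UNIV"
    and E: "\<forall>i<m. \<forall>j<m. E (v i) (v j) \<longleftrightarrow> j = (i + 1) mod m \<or> i = (j + 1) mod m"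
    using assms(2) unfolding is_cycle_graph_def by blast
  have ex: "\<exists>j<m. a = v j" for a
    using v by (metis UNIV_I bij_betw_imp_surj_on imageE lessThan_iff)
  have sym: "E i j \<Longrightarrow> E j i" for i j
    using ex[of i] ex[of j] E by metis
  have irrefl: "\<not> E i i" for i
  proof -
    obtain j where j: "j < m" "i = v j" using ex by blast
    then have "E i i \<longleftrightarrow> j = (j + 1) mod m" using E by blast
    then show ?thesis using \<open>3 \<le> m\<close> j by (auto simp: mod_Suc split: if_splits)
  qed
  obtain f :: "complex \<Rightarrow> 'v" where "inj f" using universe by blast
  moreover obtain g :: "('n set \<Rightarrow> complex) \<Rightarrow> complex" where "inj g"
    using inj_fun_complex by blast
  ultimately have inj: "inj (f \<circ> g)" by (rule inj_compose)
  obtain r :: "'n \<Rightarrow> nat" where r: "inj r"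
    using finite_imp_inj_to_nat_seg[of "UNIV :: 'n set"] by auto
  have indicator: "(\<chi> i. if i \<in> A then 1 else 0) \<in> ?Q" if "independent_set E A" for A
  proof -
    interpret independent_saur E A r
      using that sym irrefl r by unfold_locales (auto simp: independent_set_def)
    show ?thesis using inj by (rule indicator_in_squared_expectations)
  qed
  note bounds = squared_expectations_cycle_bounds[OF \<open>3 \<le> m\<close> v E sym]
  \<comment> \<open>The combinatorial bound on independent sets is read off from the operator bound
    at their indicator vectors.\<close>
  have card_le: "card A \<le> m div 2" if "independent_set E A" for A
    using bounds(3)[OF _ indicator[OF that]] by (simp add: sum.If_cases)
  \<comment> \<open>Every other vertex, stopping early enough that 2 i + 1 < m, so that the edge
    closing the cycle is avoided for odd \<open>m\<close> as well.\<close>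
  define A0 where "A0 = (\<lambda>i. v (2 * i)) ` {..<m div 2}"
  have indA0: "independent_set E A0"
    unfolding independent_set_def
  proof safe
    fix a b assume "a \<in> A0" "b \<in> A0" "E a b"
    then obtain i j where ij: "i < m div 2" "j < m div 2" "E (v (2 * i)) (v (2 * j))"
      by (auto simp: A0_def)
    then have "2 * j = (2 * i + 1) mod m \<or> 2 * i = (2 * j + 1) mod m"
      using E by auto
    moreover have "2 * i + 1 < m" "2 * j + 1 < m" using ij by auto
    ultimately have "2 * j = 2 * i + 1 \<or> 2 * i = 2 * j + 1" by simp
    then show False by presburger
  qed
  have "inj_on (\<lambda>i. v (2 * i)) {..<m div 2}"
  proof (rule inj_onI)
    fix i j assume "i \<in> {..<m div 2}" "j \<in> {..<m div 2}" "v (2 * i) = v (2 * j)"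
    then have "2 * i = 2 * j"
      by (intro inj_onD[OF bij_betw_imp_inj_on[OF v]]) auto
    then show "i = j" by simp
  qed
  then have cardA0: "card A0 = m div 2"
    by (simp add: A0_def card_image)
  have indep_num: "independence_number E = m div 2"
    unfolding independence_number_def
  proof (intro Max_eqI)
    show "m div 2 \<in> card ` {A. independent_set E A}"
      using indA0 cardA0 by (metis (mono_tags) image_eqI mem_Collect_eq)
  qed (use card_le in auto)
  show "beta TYPE('v) E = real (independence_number E)"
    unfolding beta_def indep_num
  proof (rule cSup_eq_maximum)
    show "real (m div 2) \<in> (\<lambda>q. \<Sum>i\<in>UNIV. q $ i) ` ?Q"
      using indicator[OF indA0] cardA0 by (intro image_eqI) (auto simp: sum.If_cases)
    show "x \<le> real (m div 2)" if "x \<in> (\<lambda>q. \<Sum>i\<in>UNIV. q $ i) ` ?Q" for x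
      using that bounds(3) by auto
  qed
  show "Qbar TYPE('v) E = STAB E"
  proof
    show "Qbar TYPE('v) E \<subseteq> STAB E"
      unfolding Qbar_def
    proof (rule hull_minimal)
      show "?Q \<subseteq> STAB E"
        using \<open>3 \<le> m\<close> bounds by (intro subsetI cycle_polytope_subset_STAB[OF _ v E]) auto
      show "convex (STAB E)" by (simp add: STAB_def)
    qed
    show "STAB E \<subseteq> Qbar TYPE('v) E"
      unfolding STAB_def Qbar_def
    proof (intro hull_mono subsetI)
      fix x :: "real ^ 'n" assume "x \<in> {x. (\<forall>i. x $ i \<in> {0, 1}) \<and> (\<forall>i j. E i j \<longrightarrow> x $ i * x $ j = 0)}"
      then have x: "\<And>i. x $ i = 0 \<or> x $ i = 1" "\<And>i j. E i j \<Longrightarrow> x $ i * x $ j = 0" by auto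
      have "independent_set E {i. x $ i = 1}"
        unfolding independent_set_def using x(2) by force
      moreover have "(\<chi> i. if i \<in> {i. x $ i = 1} then 1 else 0) = x"
        using x(1) by (auto simp: vec_eq_iff)
      ultimately show "x \<in> ?Q" using indicator by metis
    qed
  qed
qed

end
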